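(* For any $p\in(-\infty,0]$ there is a polynomial-time algorithm that, given any fair division instance $\mathcal{I} = \langle [m],[n],\{v_i\}_{i=1}^n\rangle$ with $m\ge n$ in which the valuation function $v_i$ of each agent $i\in[n]$ is nonnegative, normalized, monotone, and subadditive, and given value oracle access to the functions $v_i$, computes an $(m-n+1)$-approximation to the $p$-mean welfare maximization problem; that is, it computes an allocation $\mathcal{P}$ with $$\mathrm{M}_p(\mathcal{P}) \;\ge\; \frac{1}{m-n+1}\,\max_{\mathcal{A}} \mathrm{M}_p(\mathcal{A}),$$ where the maximum is over all allocations $\mathcal{A}$ of $[m]$ among the $n$ agents.
   Context: A fair division instance $\langle [m],[n],\{v_i\}_{i=1}^n\rangle$ consists of a set $[m]=\{1,\ldots,m\}$ of indivisible goods, a set $[n]=\{1,\ldots,n\}$ of agents, and for each agent $i$ a valuation function $v_i:2^{[m]}\to\mathbb{R}_+$. A valuation $v$ is normalized if $v(\emptyset)=0$, monotone if $v(A)\le v(B)$ whenever $A\subseteq B$, and subadditive if $v(A\cup B)\le v(A)+v(B)$ for all $A,B\subseteq[m]$. An allocation is a partition $\mathcal{A}=(A_1,\ldots,A_n)$ of $[m]$ into $n$ (possibly empty) bundles, agent $i$ receiving $A_i$. The $p$-mean welfare of $\mathcal{A}$ is $\mathrm{M}_p(\mathcal{A})=\left(\frac1n\sum_{i=1}^n v_i(A_i)^p\right)^{1/p}$ for $p<0$, taken to be $0$ if some $v_i(A_i)=0$; for $p=0$ it is the geometric mean $\left(\prod_{i} v_i(A_i)\right)^{1/n}$. Value oracle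 access: a query consists of an agent $i$ and a set $S\subseteq[m]$ and returns $v_i(S)$. Polynomial time means that the number of value queries and elementary operations is polynomial in $n$, $m$, and the bit length of the values. *)

theory Defs
  imports
    Complex_Main
    "HOL-Library.FuncSet"
    "HOL-Library.Disjoint_Sets"
    "HOL-Library.Log_Nat"
    "HOL-Computational_Algebra.Polynomial"
begin

section \<open>Fair division instances\<close>

text \<open>An instance with agents \<open>{1..n}\<close> and goods \<open>{1..m}\<close> is given by \<open>n\<close>, \<open>m\<close> and
  \<open>v :: nat \<Rightarrow> nat set \<Rightarrow> real\<close>; only the values \<open>v i S\<close> with \<open>i \<in> {1..n}\<close> and
  \<open>S \<subseteq> {1..m}\<close> are meaningful.\<close>

definition nonneg_valuation :: "nat \<Rightarrow> (nat set \<Rightarrow> real) \<Rightarrow> bool" where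
  "nonneg_valuation m u \<longleftrightarrow> (\<forall>S. S \<subseteq> {1..m} \<longrightarrow> 0 \<le> u S)"

definition normalized_valuation :: "(nat set \<Rightarrow> real) \<Rightarrow> bool" where
  "normalized_valuation u \<longleftrightarrow> u {} = 0"

definition monotone_valuation :: "nat \<Rightarrow> (nat set \<Rightarrow> real) \<Rightarrow> bool" where
  "monotone_valuation m u \<longleftrightarrow> (\<forall>A B. A \<subseteq> B \<and> B \<subseteq> {1..m} \<longrightarrow> u A \<le> u B)"

definition subadditive_valuation :: "nat \<Rightarrow> (nat set \<Rightarrow> real) \<Rightarrow> bool" where
  "subadditive_valuation m u \<longleftrightarrow>
     (\<forall>A B. A \<subseteq> {1..m} \<and> B \<subseteq> {1..m} \<longrightarrow> u (A \<union> B) \<le> u A + u B)"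

definition allocations :: "nat \<Rightarrow> nat \<Rightarrow> (nat \<Rightarrow> nat set) set" where
  "allocations n m =
     {A \<in> {1..n} \<rightarrow>\<^sub>E Pow {1..m}. disjoint_family_on A {1..n} \<and> (\<Union>i\<in>{1..n}. A i) = {1..m}}"

text \<open>Only \<open>p \<le> 0\<close> is intended; the zero convention below is the one for negative exponents.\<close>

definition p_mean :: "real \<Rightarrow> nat \<Rightarrow> (nat \<Rightarrow> nat set \<Rightarrow> real) \<Rightarrow> (nat \<Rightarrow> nat set) \<Rightarrow> real" where
  "p_mean p n v A =
     (if p = 0 then root n (\<Prod>i\<in>{1..n}. v i (A i))
      else if \<exists>i\<in>{1..n}. v i (A i) = 0 then 0
      else ((1 / real n) * (\<Sum>i\<in>{1..n}. v i (A i) powr p)) powr (1 / p))"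

text \<open>The size of a rational is the number of binary digits of its reduced numerator and
  denominator. An irrational value has no finite bit length; it is an atomic datum of the real
  arithmetic model below and has size one.\<close>

definition value_bits :: "real \<Rightarrow> nat" where
  "value_bits x =
     (if x \<in> \<rat> then
        (let (a, b) = quotient_of (the_inv (of_rat :: rat \<Rightarrow> real) x)
         in floorlog 2 (nat \<bar>a\<bar>) + floorlog 2 (nat b))
      else 1)"

text \<open>This is a maximum and not a sum: a sum over the \<open>2 ^ m\<close> bundles would make every
  exponential running time polynomial in it.\<close>

definition valuation_bits :: "nat \<Rightarrow> nat \<Rightarrow> (nat \<Rightarrow> nat set \<Rightarrow> real) \<Rightarrow> nat" where
  "valuation_bits n m v = Max ((\<lambda>(i, S). value_bits (v i S)) ` ({1..n} \<times> Pow {1..m}))"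


section \<open>Algorithms with value oracle access\<close>

text \<open>A uniform random access machine over the reals, as a while language. The store consists of
  arrays of natural numbers (for indices, counters and sets of goods) and arrays of real numbers
  (for values); a scalar is an array cell with index 0. Each operation has unit cost. Natural
  numbers can only be added and subtracted (truncating at 0), and there is no conversion (floor)
  from reals to naturals, which rules out the usual ways of packing long computations into a few
  unit-cost operations on huge numbers. Real
  arithmetic is exact and includes, besides the field operations and comparison, the power with
  the exponent \<open>p\<close> of the welfare objective.\<close>

type_synonym vname = string

record store =
  nmem :: "vname \<Rightarrow> nat \<Rightarrow> nat"
  rmem :: "vname \<Rightarrow> nat \<Rightarrow> real"

datatype nexp =
    NConst nat
  | NGet vname nexp
  | NPlus nexp nexp
  | NMinus nexp nexp

datatype rexp =
    RConst nat
  | RGet vname nexp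
  | RPlus rexp rexp
  | RMinus rexp rexp
  | RTimes rexp rexp
  | RDivide rexp rexp
  | RPower rexp

datatype bexp =
    NLess nexp nexp
  | RLess rexp rexp
  | BNot bexp
  | BAnd bexp bexp

primrec nval :: "store \<Rightarrow> nexp \<Rightarrow> nat" where
  "nval s (NConst k) = k"
| "nval s (NGet x e) = nmem s x (nval s e)"
| "nval s (NPlus e f) = nval s e + nval s f"
| "nval s (NMinus e f) = nval s e - nval s f"

text \<open>Division by zero yields 0, and so does a power with a base that is not positive.\<close>

primrec rval :: "real \<Rightarrow> store \<Rightarrow> rexp \<Rightarrow> real" where
  "rval p s (RConst k) = real k"
| "rval p s (RGet x e) = rmem s x (nval s e)"
| "rval p s (RPlus e f) = rval p s e + rval p s f"
| "rval p s (RMinus e f) = rval p s e - rval p s f"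
| "rval p s (RTimes e f) = rval p s e * rval p s f"
| "rval p s (RDivide e f) = rval p s e / rval p s f"
| "rval p s (RPower e) = (if 0 < rval p s e then rval p s e powr p else 0)"

primrec bval :: "real \<Rightarrow> store \<Rightarrow> bexp \<Rightarrow> bool" where
  "bval p s (NLess e f) = (nval s e < nval s f)"
| "bval p s (RLess e f) = (rval p s e < rval p s f)"
| "bval p s (BNot b) = (\<not> bval p s b)"
| "bval p s (BAnd b c) = (bval p s b \<and> bval p s c)"

primrec ncost :: "nexp \<Rightarrow> nat" where
  "ncost (NConst k) = 1"
| "ncost (NGet x e) = 1 + ncost e"
| "ncost (NPlus e f) = 1 + ncost e + ncost f"
| "ncost (NMinus e f) = 1 + ncost e + ncost f"

primrec rcost :: "rexp \<Rightarrow> nat" where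
  "rcost (RConst k) = 1"
| "rcost (RGet x e) = 1 + ncost e"
| "rcost (RPlus e f) = 1 + rcost e + rcost f"
| "rcost (RMinus e f) = 1 + rcost e + rcost f"
| "rcost (RTimes e f) = 1 + rcost e + rcost f"
| "rcost (RDivide e f) = 1 + rcost e + rcost f"
| "rcost (RPower e) = 1 + rcost e"

primrec bcost :: "bexp \<Rightarrow> nat" where
  "bcost (NLess e f) = 1 + ncost e + ncost f"
| "bcost (RLess e f) = 1 + rcost e + rcost f"
| "bcost (BNot b) = 1 + bcost b"
| "bcost (BAnd b c) = 1 + bcost b + bcost c"

text \<open>\<open>Query x k i y\<close> stores in \<open>x[k]\<close> the value of the valuation of agent \<open>i\<close> at the set of
  goods whose characteristic vector is the array \<open>y\<close>.\<close>

datatype com =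
    Skip
  | NAssign vname nexp nexp
  | RAssign vname nexp rexp
  | Query vname nexp nexp vname
  | Seq com com
  | If bexp com com
  | While bexp com

definition nupd :: "vname \<Rightarrow> nat \<Rightarrow> nat \<Rightarrow> store \<Rightarrow> store" where
  "nupd x k a s = s\<lparr>nmem := (nmem s)(x := (nmem s x)(k := a))\<rparr>"

definition rupd :: "vname \<Rightarrow> nat \<Rightarrow> real \<Rightarrow> store \<Rightarrow> store" where
  "rupd x k a s = s\<lparr>rmem := (rmem s)(x := (rmem s x)(k := a))\<rparr>"

text \<open>\<open>exec p n m v c s t s'\<close>: program \<open>c\<close> started in \<open>s\<close> halts in \<open>s'\<close> after \<open>t\<close> elementary
  operations and value queries. The valuations are accessed through queries only, and a query to
  an agent outside \<open>{1..n}\<close> is a fatal error: the execution has no result.\<close>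

inductive exec ::
  "real \<Rightarrow> nat \<Rightarrow> nat \<Rightarrow> (nat \<Rightarrow> nat set \<Rightarrow> real) \<Rightarrow> com \<Rightarrow> store \<Rightarrow> nat \<Rightarrow> store \<Rightarrow> bool"
  for p :: real and n m :: nat and v :: "nat \<Rightarrow> nat set \<Rightarrow> real"
where
  Skip: "exec p n m v Skip s 1 s"
| NAssign: "exec p n m v (NAssign x k e) s (1 + ncost k + ncost e)
    (nupd x (nval s k) (nval s e) s)"
| RAssign: "exec p n m v (RAssign x k e) s (1 + ncost k + rcost e)
    (rupd x (nval s k) (rval p s e) s)"
| Query: "nval s i \<in> {1..n} \<Longrightarrow>
    exec p n m v (Query x k i y) s (1 + ncost k + ncost i)
      (rupd x (nval s k) (v (nval s i) {j \<in> {1..m}. nmem s y j \<noteq> 0}) s)"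
| Seq: "exec p n m v c s t s' \<Longrightarrow> exec p n m v d s' t' s'' \<Longrightarrow>
    exec p n m v (Seq c d) s (t + t') s''"
| IfTrue: "bval p s b \<Longrightarrow> exec p n m v c s t s' \<Longrightarrow>
    exec p n m v (If b c d) s (1 + bcost b + t) s'"
| IfFalse: "\<not> bval p s b \<Longrightarrow> exec p n m v d s t s' \<Longrightarrow>
    exec p n m v (If b c d) s (1 + bcost b + t) s'"
| WhileFalse: "\<not> bval p s b \<Longrightarrow> exec p n m v (While b c) s (1 + bcost b) s"
| WhileTrue: "bval p s b \<Longrightarrow> exec p n m v c s t s' \<Longrightarrow> exec p n m v (While b c) s' t' s'' \<Longrightarrow>
    exec p n m v (While b c) s (1 + bcost b + t + t') s''"

lemma exec_deterministic:
  "exec p n m v c s t s' \<Longrightarrow> exec p n m v c s u s'' \<Longrightarrow> u = t \<and> s'' = s'"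
proof (induction arbitrary: u s'' rule: exec.induct)
  case (Skip s)
  then show ?case by cases simp
next
  case (NAssign x k e s)
  then show ?case by cases simp
next
  case (RAssign x k e s)
  then show ?case by cases simp
next
  case (Query s i x k y)
  from Query.prems show ?case by cases simp
next
  case (Seq c s t s' d t' s1)
  from Seq.prems show ?case by cases (metis Seq.IH)
next
  case (IfTrue s b c t s' d)
  from IfTrue.prems show ?case
  proof cases
    case run: (IfTrue t1)
    then show ?thesis using IfTrue.IH by metis
  next
    case IfFalse
    then show ?thesis using IfTrue.hyps by metis
  qed
next
  case (IfFalse s b d t s' c)
  from IfFalse.prems show ?case
  proof cases
    case IfTrue
    then show ?thesis using IfFalse.hyps by metis
  next
    case run: (IfFalse t1)
    then show ?thesis using IfFalse.IH by metis
  qed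
next
  case (WhileFalse s b c)
  from WhileFalse.prems show ?case
  proof cases
    case WhileFalse
    then show ?thesis by simp
  next
    case WhileTrue
    then show ?thesis using WhileFalse.hyps by metis
  qed
next
  case (WhileTrue s b c t s' t' s1)
  from WhileTrue.prems show ?case
  proof cases
    case WhileFalse
    then show ?thesis using WhileTrue.hyps by metis
  next
    case run: (WhileTrue t1 r t2)
    then show ?thesis using WhileTrue.IH by metis
  qed
qed

definition init_store :: "nat \<Rightarrow> nat \<Rightarrow> store" where
  "init_store n m =
     \<lparr>nmem = (\<lambda>x k. if x = ''n'' \<and> k = 0 then n else if x = ''m'' \<and> k = 0 then m else 0),
      rmem = (\<lambda>x k. 0)\<rparr>"

text \<open>The result is read off the array \<open>owner\<close>: good \<open>j\<close> is given to agent \<open>owner[j]\<close>. This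
  is an allocation iff all these entries lie in \<open>{1..n}\<close>.\<close>

definition output_allocation :: "nat \<Rightarrow> nat \<Rightarrow> store \<Rightarrow> nat \<Rightarrow> nat set" where
  "output_allocation n m s = (\<lambda>i\<in>{1..n}. {j \<in> {1..m}. nmem s ''owner'' j = i})"

end

theory Submission
  imports Defs
begin

text \<open>Allocate one good to each agent by an optimal assignment, and the remaining goods arbitrarily.
  If all bundles of an allocation have positive value, they are nonempty, so each contains at most
  \<open>m - n + 1\<close> goods; by subadditivity agent \<open>i\<close> has in its bundle a good that is worth a
  \<open>1 / (m - n + 1)\<close> fraction of it. These goods are distinct, so some assignment of single goods
  attains this fraction of the optimal \<open>p\<close>-mean welfare. A best assignment minimizes the sum of
  \<open>v\<^sub>i({j}) powr p\<close> for \<open>p < 0\<close> and the sum of \<open>- ln (v\<^sub>i({j}))\<close> for \<open>p = 0\<close>, over the pairs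
  of positive value. The Hungarian method finds it, inserting the agents one by one: an
  alternating tree is grown along edges made tight by shifting dual potentials, until it reaches an
  unowned good and the matching is augmented. If the tree gets stuck, Hall's condition fails and the
  optimal welfare is zero.\<close>

section \<open>Invariants of the Hungarian method\<close>

text \<open>Values may be irrational, so no integrality or scaling argument can bound the running
  time; every loop needs a combinatorial variant, either the size of the alternating tree or the
  rank of a column in it. For p \<le> 0 a worthless good has infinite cost. Such pairs are therefore
  left out of the graph instead of getting a large finite cost, and a stuck search becomes a regular
  outcome. Any allocation is then good enough. Optimality is certified by linear programming
  duality. Potentials and ranks are ghost variables of purely combinatorial states, and the program
  is later shown to move from one such state to the next. This keeps the matching theory apart from
  the store, where potentials occur only in encoded form.\<close>

lemma bij_betw_fun_upd_insert:
  assumes "bij_betw f A B" "x \<notin> A" "y \<notin> B"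
  shows "bij_betw (f(x := y)) (insert x A) (insert y B)"
proof -
  have "bij_betw (f(x := y)) A B"
    using assms(1,2) by (subst bij_betw_cong[where g = f]) auto
  then show ?thesis
    using notIn_Un_bij_betw[of x A "f(x := y)" B] assms(2,3) by simp
qed

locale matching_problem =
  fixes m :: nat and edge :: "nat \<Rightarrow> nat \<Rightarrow> bool" and cost :: "nat \<Rightarrow> nat \<Rightarrow> real"
begin

section \<open>Matchings, dual potentials and alternating trees\<close>

definition matched :: "nat \<Rightarrow> (nat \<Rightarrow> nat) \<Rightarrow> nat set" where
  "matched h own = {j. j \<le> m \<and> j \<noteq> h \<and> own j \<noteq> 0}"

text \<open>Column \<open>0\<close> is a dummy good that holds the agent being inserted. The hole \<open>h\<close> is a column
  whose owner is about to be overwritten by an augmentation; \<open>h = Suc m\<close> means that there is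
  none.\<close>

definition tight_matching ::
    "nat \<Rightarrow> nat \<Rightarrow> (nat \<Rightarrow> nat) \<Rightarrow> (nat \<Rightarrow> real) \<Rightarrow> (nat \<Rightarrow> real) \<Rightarrow> bool" where
  "tight_matching k h own U V \<longleftrightarrow>
     bij_betw own (matched h own) {1..k} \<and>
     (\<forall>j\<in>matched h own - {0}. edge (own j) j \<and> U (own j) + V j = cost (own j) j) \<and>
     (\<forall>j\<in>{1..m}. V j \<le> 0 \<and> (j \<noteq> h \<and> own j = 0 \<longrightarrow> V j = 0))"

text \<open>Constraints of the dual of the assignment problem, imposed on edges only. The condition
  \<open>V j \<le> 0\<close> in \<open>tight_matching\<close> belongs to the same dual, as goods
  need not all be assigned; \<open>V j = 0\<close> on unowned goods is complementary
  slackness.\<close>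

definition dual_feasible :: "nat set \<Rightarrow> (nat \<Rightarrow> real) \<Rightarrow> (nat \<Rightarrow> real) \<Rightarrow> bool" where
  "dual_feasible K U V \<longleftrightarrow> (\<forall>i\<in>K. \<forall>j\<in>{1..m}. edge i j \<longrightarrow> U i + V j \<le> cost i j)"

text \<open>\<open>way\<close> points to the parent column; the ghost rank \<open>r\<close> decreases along it.\<close>

definition alternating_tree ::
    "nat set \<Rightarrow> nat \<Rightarrow> (nat \<Rightarrow> nat) \<Rightarrow> (nat \<Rightarrow> nat) \<Rightarrow> (nat \<Rightarrow> nat) \<Rightarrow>
     (nat \<Rightarrow> real) \<Rightarrow> (nat \<Rightarrow> real) \<Rightarrow> bool" where
  "alternating_tree R cur own way r U V \<longleftrightarrow>
     0 \<in> R \<and> r 0 = 0 \<and> R \<subseteq> {..m} \<and> cur \<in> R \<and>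
     (\<forall>j\<in>R - {cur}. own j \<noteq> 0) \<and> (\<forall>j\<in>R. r j \<le> r cur) \<and>
     (\<forall>j\<in>R - {0}. way j \<in> R \<and> r (way j) < r j \<and>
        edge (own (way j)) j \<and> U (own (way j)) + V j = cost (own (way j)) j)"

text \<open>Between insertions the hole is the dummy column, so whatever owner it still stores is
  ignored and only real goods count as matched.\<close>

definition base_state :: "nat \<Rightarrow> (nat \<Rightarrow> nat) \<Rightarrow> (nat \<Rightarrow> real) \<Rightarrow> (nat \<Rightarrow> real) \<Rightarrow> bool" where
  "base_state k own U V \<longleftrightarrow> tight_matching k 0 own U V \<and> dual_feasible {1..k} U V"

text \<open>While \<open>R = {0}\<close>, the new agent \<open>k\<close> is exempt from dual
  feasibility, so its potential may start anywhere; the first growth step makes it feasible. The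
  bound \<open>r cur < card R\<close> limits the length of the later augmentation.\<close>

definition search_state ::
    "nat \<Rightarrow> nat set \<Rightarrow> nat \<Rightarrow> (nat \<Rightarrow> nat) \<Rightarrow> (nat \<Rightarrow> nat) \<Rightarrow> (nat \<Rightarrow> nat) \<Rightarrow>
     (nat \<Rightarrow> real) \<Rightarrow> (nat \<Rightarrow> real) \<Rightarrow> bool" where
  "search_state k R cur own way r U V \<longleftrightarrow>
     own 0 = k \<and> 1 \<le> k \<and> tight_matching k (Suc m) own U V \<and>
     dual_feasible (if R = {0} then {1..k} - {k} else {1..k}) U V \<and>
     alternating_tree R cur own way r U V \<and> r cur < card R"

definition augment_state ::
    "nat \<Rightarrow> nat set \<Rightarrow> nat \<Rightarrow> (nat \<Rightarrow> nat) \<Rightarrow> (nat \<Rightarrow> nat) \<Rightarrow> (nat \<Rightarrow> nat) \<Rightarrow>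
     (nat \<Rightarrow> real) \<Rightarrow> (nat \<Rightarrow> real) \<Rightarrow> bool" where
  "augment_state k R cur own way r U V \<longleftrightarrow>
     tight_matching k cur own U V \<and> dual_feasible {1..k} U V \<and>
     alternating_tree R cur own way r U V"

section \<open>Growing the tree, augmenting along it, and optimality\<close>

lemma search_state_start:
  assumes "base_state k own U V"
  shows "search_state (Suc k) {0} 0 (own(0 := Suc k)) way (\<lambda>_. 0) (U(Suc k := x)) V"
proof -
  let ?own = "own(0 := Suc k)"
  have M: "matched (Suc m) ?own = insert 0 (matched 0 own)" "0 \<notin> matched 0 own"
    by (auto simp: matched_def)
  have b: "bij_betw own (matched 0 own) {1..k}"
    using assms by (auto simp: base_state_def tight_matching_def)
  have "bij_betw ?own (insert 0 (matched 0 own)) (insert (Suc k) {1..k})"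
    using b M(2) by (intro bij_betw_fun_upd_insert) auto
  moreover have "insert (Suc k) {1..k} = {1..Suc k}" by auto
  moreover have "own j \<in> {1..k}" if "j \<in> matched 0 own" for j
    using b that by (auto simp: bij_betw_def)
  ultimately show ?thesis
    using assms M
    unfolding search_state_def base_state_def tight_matching_def dual_feasible_def
      alternating_tree_def
    by (fastforce simp: matched_def)
qed

text \<open>Raising the tree agents and lowering the tree columns by the same \<open>d\<close> keeps
  matched edges and tree edges tight. Edges from outside agents into the tree gain slack, edges
  leaving the tree stay feasible because \<open>d\<close> is the least slack, and
  \<open>(a, b)\<close> becomes tight.\<close>

lemma search_state_step:
  assumes S: "search_state k R cur own way r U V"
    and "own cur \<noteq> 0" "a \<in> R" "b \<notin> R" "b \<le> m" "edge (own a) b"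
    and d: "d = cost (own a) b - U (own a) - V b"
    and min: "\<And>a' b'. a' \<in> R \<Longrightarrow> b' \<notin> R \<Longrightarrow> b' \<le> m \<Longrightarrow> edge (own a') b' \<Longrightarrow>
                d \<le> cost (own a') b' - U (own a') - V b'"
  shows "search_state k (insert b R) b own (way(b := a)) (r(b := card R))
           (\<lambda>i. if i \<in> own ` R then U i + d else U i) (\<lambda>j. if j \<in> R then V j - d else V j)"
proof -
  let ?U = "\<lambda>i. if i \<in> own ` R then U i + d else U i"
  let ?V = "\<lambda>j. if j \<in> R then V j - d else V j"
  note [simp] = dual_feasible_def
  have own0: "own 0 = k" "1 \<le> k" and tm: "tight_matching k (Suc m) own U V"
    and df: "dual_feasible (if R = {0} then {1..k} - {k} else {1..k}) U V"
    and tr: "alternating_tree R cur own way r U V" and rc: "r cur < card R"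
    using S by (auto simp: search_state_def)
  let ?M = "matched (Suc m) own"
  have bij: "bij_betw own ?M {1..k}" using tm by (simp add: tight_matching_def)
  have R: "0 \<in> R" "R \<subseteq> {..m}" "finite R" "cur \<in> R" and nz: "\<And>j. j \<in> R \<Longrightarrow> own j \<noteq> 0"
    using tr \<open>own cur \<noteq> 0\<close> finite_subset[of R "{..m}"]
    by (auto simp: alternating_tree_def)
  have RM: "R \<subseteq> ?M" using R nz by (auto simp: matched_def)
  have ownR: "own j \<in> {1..k}" if "j \<in> R" for j
    using bij_betwE[OF bij] RM that by blast
  have b0: "b \<noteq> 0" using \<open>b \<notin> R\<close> R by metis
  have mem: "own j \<in> own ` R \<longleftrightarrow> j \<in> R" if "j \<in> ?M" for j
    using that RM bij by (auto simp: bij_betw_def dest: inj_onD)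
  \<comment> \<open>Only the first growth can have a negative \<open>d\<close>. The tree then
    contains no real good, so no \<open>V j\<close> with \<open>j\<close> in \<open>{1..m}\<close>
    changes, and the only agent that is shifted is the new one.\<close>
  have d0: "0 \<le> d" if "R \<noteq> {0}"
    using df that ownR[OF \<open>a \<in> R\<close>] \<open>b \<le> m\<close> b0 \<open>edge (own a) b\<close> d by force
  have "edge (own j) j \<and> ?U (own j) + ?V j = cost (own j) j" if "j \<in> ?M - {0}" for j
    using that tm mem[of j] by (auto simp: tight_matching_def)
  moreover have "?V j \<le> 0 \<and> (j \<noteq> Suc m \<and> own j = 0 \<longrightarrow> ?V j = 0)" if "j \<in> {1..m}" for j
  proof -
    have "V j \<le> 0" "own j = 0 \<longrightarrow> V j = 0"
      using tm that by (auto simp: tight_matching_def)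
    moreover have "R \<noteq> {0}" if "j \<in> R" using that \<open>j \<in> {1..m}\<close> by auto
    ultimately show ?thesis using d0 nz by force
  qed
  ultimately have 1: "tight_matching k (Suc m) own ?U ?V"
    using bij by (simp add: tight_matching_def)
  have "?U i + ?V j \<le> cost i j" if "i \<in> {1..k}" "j \<in> {1..m}" "edge i j" for i j
  proof (cases "j \<in> R")
    case True
    then have "R \<noteq> {0}" using that by auto
    then have "U i + V j \<le> cost i j" using df that by auto
    then show ?thesis using d0[OF \<open>R \<noteq> {0}\<close>] True by auto
  next
    case False
    show ?thesis
    proof (cases "i \<in> own ` R")
      case True
      then obtain a' where "a' \<in> R" "i = own a'" by auto
      then show ?thesis using min[of a' j] that False by auto
    next
      case i: False
      then have "i \<noteq> k" using own0 R by auto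
      then have "U i + V j \<le> cost i j" using df that by (auto split: if_splits)
      then show ?thesis using i False by auto
    qed
  qed
  then have 2: "dual_feasible {1..k} ?U ?V" by simp
  \<comment> \<open>The rank \<open>card R\<close> of the new column thus exceeds all ranks in the
    tree, and it is below the size of the enlarged tree.\<close>
  have "r j < card R" if "j \<in> R" for j
    using tr rc that by (force simp: alternating_tree_def)
  then have 3: "alternating_tree (insert b R) b own (way(b := a)) (r(b := card R)) ?U ?V"
    using R nz \<open>b \<notin> R\<close> \<open>a \<in> R\<close> \<open>b \<le> m\<close> \<open>edge (own a) b\<close> d b0 tr
    unfolding alternating_tree_def
    by (auto intro: less_imp_le)
  show ?thesis
    using 1 2 3 own0 R(3) \<open>b \<notin> R\<close> R(1) by (auto simp: search_state_def)
qed

lemma search_state_owner: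
  assumes "search_state k R cur own way r U V" "own cur \<noteq> 0" "j \<in> R"
  shows "own j \<in> {1..k}"
proof -
  have "j \<in> matched (Suc m) own"
    using assms by (auto simp: matched_def search_state_def alternating_tree_def)
  then show ?thesis using assms(1) by (auto simp: search_state_def tight_matching_def bij_betw_def)
qed

text \<open>A search tree without outgoing edge violates Hall's condition: its \<open>card R\<close> agents only
  accept the \<open>card R - 1\<close> goods in \<open>R - {0}\<close>.\<close>

lemma search_state_stuck:
  assumes S: "search_state k R cur own way r U V" and "own cur \<noteq> 0" and "k \<le> n"
    and stuck: "\<And>a b. a \<in> R \<Longrightarrow> b \<notin> R \<Longrightarrow> b \<le> m \<Longrightarrow> \<not> edge (own a) b"
    and \<sigma>: "inj_on \<sigma> {1..n}" "\<And>i. i \<in> {1..n} \<Longrightarrow> \<sigma> i \<in> {1..m} \<and> edge i (\<sigma> i)"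
  shows False
proof -
  have R: "R \<subseteq> matched (Suc m) own" "finite R" "0 \<in> R"
    using S \<open>own cur \<noteq> 0\<close> finite_subset[of R "{..m}"]
    by (auto simp: matched_def search_state_def alternating_tree_def)
  have inj: "inj_on own R"
    using S R by (auto simp: search_state_def tight_matching_def bij_betw_def intro: inj_on_subset)
  have sub: "own ` R \<subseteq> {1..n}"
    using search_state_owner[OF S \<open>own cur \<noteq> 0\<close>] \<open>k \<le> n\<close> by fastforce
  have "\<sigma> ` own ` R \<subseteq> R - {0}"
  proof clarify
    fix j assume j: "j \<in> R"
    then have "own j \<in> {1..n}" using sub by auto
    then have "\<sigma> (own j) \<in> {1..m}" "edge (own j) (\<sigma> (own j))" using \<sigma> by auto
    then show "\<sigma> (own j) \<in> R - {0}" using stuck[OF j, of "\<sigma> (own j)"] by auto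
  qed
  then have "card (\<sigma> ` own ` R) \<le> card (R - {0})" using R by (intro card_mono) auto
  moreover have "card (\<sigma> ` own ` R) = card R"
    using inj sub \<sigma>(1) by (simp add: card_image inj_on_subset)
  moreover have "card (R - {0}) < card R" using R by (intro psubset_card_mono) auto
  ultimately show False by simp
qed

text \<open>An unowned column is not matched, so declaring it the hole changes nothing. It differs
  from the dummy column, which is owned by \<open>k\<close>; hence the tree has grown and all of
  \<open>{1..k}\<close> is dual feasible.\<close>

lemma search_state_found:
  assumes S: "search_state k R cur own way r U V" and "own cur = 0"
  shows "augment_state k R cur own way r U V"
proof -
  have "matched cur own = matched (Suc m) own"
    using \<open>own cur = 0\<close> by (auto simp: matched_def)
  moreover have "R \<noteq> {0}" using S \<open>own cur = 0\<close> by (auto simp: search_state_def alternating_tree_def)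
  ultimately show ?thesis
    using S by (auto simp: search_state_def augment_state_def tight_matching_def)
qed

text \<open>Copying the parent's owner into \<open>cur\<close> uses a tight tree edge and moves the
  hole to the parent. Tree edges that start at the overwritten column may now be wrong, so only the
  columns of rank at most that of the new hole are kept; this still contains the rest of the path to
  column \<open>0\<close>.\<close>

lemma augment_state_step:
  assumes S: "augment_state k R cur own way r U V" and "cur \<noteq> 0"
  shows "augment_state k {j \<in> R. r j \<le> r (way cur)} (way cur) (own(cur := own (way cur))) way r U V"
    and "r (way cur) < r cur" and "way cur \<noteq> cur"
proof -
  have tm: "tight_matching k cur own U V" and tr: "alternating_tree R cur own way r U V"
    using S by (auto simp: augment_state_def)
  define par where "par = way cur"
  have par: "par \<in> R" "r par < r cur" "edge (own par) cur" "U (own par) + V cur = cost (own par) cur"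
    "cur \<in> R" "R \<subseteq> {..m}"
    using tr \<open>cur \<noteq> 0\<close> by (auto simp: alternating_tree_def par_def)
  then have ne: "par \<noteq> cur" by auto
  have nz: "own par \<noteq> 0" using tr par ne by (auto simp: alternating_tree_def)
  let ?own = "own(cur := own par)"
  let ?M = "matched cur own"
  have parM: "par \<in> ?M" using par ne nz by (auto simp: matched_def)
  have curM: "cur \<notin> ?M" by (simp add: matched_def)
  have M': "matched par ?own = insert cur (?M - {par})"
    using par ne nz by (auto simp: matched_def)
  have bij: "bij_betw own ?M {1..k}" using tm by (simp add: tight_matching_def)
  have "bij_betw own (?M - {par}) ({1..k} - {own par})"
    using bij parM bij_betw_imp_surj_on[OF bij] by (intro bij_betw_DiffI) auto
  then have "bij_betw ?own (insert cur (?M - {par})) (insert (own par) ({1..k} - {own par}))"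
    using curM by (intro bij_betw_fun_upd_insert) auto
  moreover have "insert (own par) ({1..k} - {own par}) = {1..k}"
    using parM bij_betwE[OF bij] by blast
  ultimately have "bij_betw ?own (matched par ?own) {1..k}" using M' by simp
  moreover have "edge (?own j) j \<and> U (?own j) + V j = cost (?own j) j"
    if "j \<in> matched par ?own - {0}" for j
    using that tm par unfolding M' by (auto simp: tight_matching_def)
  moreover have "V j \<le> 0 \<and> (j \<noteq> par \<and> ?own j = 0 \<longrightarrow> V j = 0)" if "j \<in> {1..m}" for j
    using tm that nz by (auto simp: tight_matching_def)
  ultimately have 1: "tight_matching k par ?own U V" by (simp add: tight_matching_def)
  have 2: "alternating_tree {j \<in> R. r j \<le> r par} par ?own way r U V"
  proof -
    have "way j \<in> R \<and> r (way j) \<le> r par \<and> r (way j) < r j \<and>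
        edge (?own (way j)) j \<and> U (?own (way j)) + V j = cost (?own (way j)) j"
      if "j \<in> R" "r j \<le> r par" "j \<noteq> 0" for j
    proof -
      have j: "way j \<in> R" "r (way j) < r j" "edge (own (way j)) j"
          "U (own (way j)) + V j = cost (own (way j)) j"
        using tr that by (auto simp: alternating_tree_def)
      \<comment> \<open>The rank of \<open>way j\<close> is below \<open>r par\<close>, hence below
        \<open>r cur\<close>: no kept tree edge starts at the column just overwritten.\<close>
      then have "way j \<noteq> cur" using par that by auto
      then show ?thesis using j that by auto
    qed
    moreover have "0 \<in> R" "r 0 = 0" "\<And>j. j \<in> R - {cur} \<Longrightarrow> own j \<noteq> 0"
      using tr by (auto simp: alternating_tree_def)
    ultimately show ?thesis using par nz by (auto simp: alternating_tree_def)
  qed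
  show "augment_state k {j \<in> R. r j \<le> r (way cur)} (way cur) (own(cur := own (way cur))) way r U V"
    using 1 2 S by (simp add: augment_state_def par_def)
  show "r (way cur) < r cur" "way cur \<noteq> cur" using par ne by (auto simp: par_def)
qed

lemma augment_state_finish:
  "augment_state k R 0 own way r U V \<Longrightarrow> base_state k own U V"
  by (simp add: augment_state_def base_state_def)

text \<open>Weak duality. By tightness the cost of the matching is the sum of all \<open>U i\<close>
  and of \<open>V\<close> over all goods, since unowned goods contribute zero. Dropping the
  nonpositive terms outside the range of another assignment \<open>\<sigma>\<close> can only
  increase this sum, and dual feasibility bounds the result by the cost of
  \<open>\<sigma>\<close>.\<close>

lemma base_state_optimal:
  assumes "base_state n own U V"
  obtains \<mu> where "\<And>i. i \<in> {1..n} \<Longrightarrow> \<mu> i \<in> {1..m} \<and> own (\<mu> i) = i \<and> edge i (\<mu> i)"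
    and "\<And>\<sigma>. inj_on \<sigma> {1..n} \<Longrightarrow> (\<And>i. i \<in> {1..n} \<Longrightarrow> \<sigma> i \<in> {1..m} \<and> edge i (\<sigma> i)) \<Longrightarrow>
           (\<Sum>i\<in>{1..n}. cost i (\<mu> i)) \<le> (\<Sum>i\<in>{1..n}. cost i (\<sigma> i))"
proof -
  let ?M = "matched 0 own"
  have tm: "tight_matching n 0 own U V" and df: "dual_feasible {1..n} U V"
    using assms by (auto simp: base_state_def)
  have bij: "bij_betw own ?M {1..n}" using tm by (simp add: tight_matching_def)
  define \<mu> where "\<mu> = the_inv_into ?M own"
  have b\<mu>: "bij_betw \<mu> {1..n} ?M" using bij_betw_the_inv_into[OF bij] by (simp add: \<mu>_def)
  have own\<mu>: "own (\<mu> i) = i" if "i \<in> {1..n}" for i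
    using bij that unfolding \<mu>_def by (metis f_the_inv_into_f_bij_betw)
  have M: "?M \<subseteq> {1..m}" by (auto simp: matched_def)
  have \<mu>: "\<mu> i \<in> ?M" if "i \<in> {1..n}" for i using b\<mu> that by (auto simp: bij_betw_def)
  have pair: "edge i (\<mu> i) \<and> U i + V (\<mu> i) = cost i (\<mu> i)" if "i \<in> {1..n}" for i
  proof -
    have "\<mu> i \<in> ?M - {0}" using \<mu>[OF that] by (auto simp: matched_def)
    with tm have "edge (own (\<mu> i)) (\<mu> i) \<and> U (own (\<mu> i)) + V (\<mu> i) = cost (own (\<mu> i)) (\<mu> i)"
      unfolding tight_matching_def by blast
    then show ?thesis by (simp add: own\<mu>[OF that])
  qed
  show ?thesis
  proof (rule that[of \<mu>])
    fix i assume i: "i \<in> {1..n}"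
    then show "\<mu> i \<in> {1..m} \<and> own (\<mu> i) = i \<and> edge i (\<mu> i)"
      using \<mu>[OF i] M own\<mu>[OF i] pair[OF i] by blast
  next
    fix \<sigma> assume inj: "inj_on \<sigma> {1..n}"
      and \<sigma>: "\<And>i. i \<in> {1..n} \<Longrightarrow> \<sigma> i \<in> {1..m} \<and> edge i (\<sigma> i)"
    have "(\<Sum>i\<in>{1..n}. cost i (\<mu> i)) = (\<Sum>i\<in>{1..n}. U i) + (\<Sum>i\<in>{1..n}. V (\<mu> i))"
      using pair by (simp add: sum.distrib[symmetric])
    also have "(\<Sum>i\<in>{1..n}. V (\<mu> i)) = (\<Sum>j\<in>?M. V j)"
      using b\<mu> by (rule sum.reindex_bij_betw)
    also have "\<dots> = (\<Sum>j\<in>{1..m}. V j)"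
      using M tm by (intro sum.mono_neutral_left) (auto simp: matched_def tight_matching_def)
    also have "\<dots> \<le> (\<Sum>j\<in>\<sigma> ` {1..n}. V j)"
    proof -
      have "(\<Sum>j\<in>{1..m}. V j) = (\<Sum>j\<in>\<sigma> ` {1..n}. V j) + (\<Sum>j\<in>{1..m} - \<sigma> ` {1..n}. V j)"
        using \<sigma> by (subst add.commute, intro sum.subset_diff) auto
      moreover have "(\<Sum>j\<in>{1..m} - \<sigma> ` {1..n}. V j) \<le> 0"
        using tm by (intro sum_nonpos) (auto simp: tight_matching_def)
      ultimately show ?thesis by simp
    qed
    also have "\<dots> = (\<Sum>i\<in>{1..n}. V (\<sigma> i))" using inj by (simp add: sum.reindex)
    also have "(\<Sum>i\<in>{1..n}. U i) + (\<Sum>i\<in>{1..n}. V (\<sigma> i)) \<le> (\<Sum>i\<in>{1..n}. cost i (\<sigma> i))"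
      unfolding sum.distrib[symmetric] using df \<sigma>
      by (intro sum_mono) (auto simp: dual_feasible_def)
    finally show "(\<Sum>i\<in>{1..n}. cost i (\<mu> i)) \<le> (\<Sum>i\<in>{1..n}. cost i (\<sigma> i))" by simp
  qed
qed

end

section \<open>Weakest preconditions with running time\<close>

definition wp ::
    "real \<Rightarrow> nat \<Rightarrow> nat \<Rightarrow> (nat \<Rightarrow> nat set \<Rightarrow> real) \<Rightarrow> com \<Rightarrow> (nat \<Rightarrow> store \<Rightarrow> bool) \<Rightarrow> store \<Rightarrow> bool" where
  "wp p n m v c Q s \<longleftrightarrow> (\<exists>t s'. exec p n m v c s t s' \<and> Q t s')"

inductive_simps exec_loop_free:
  "exec p n m v Skip s t s'"
  "exec p n m v (NAssign x k e) s t s'"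
  "exec p n m v (RAssign x k f) s t s'"
  "exec p n m v (Query x k i y) s t s'"
  "exec p n m v (Seq c d) s t s'"
  "exec p n m v (If b c d) s t s'"

text \<open>As simplification rules these execute straight-line code symbolically together with its
  exact cost, which leaves only loops to be treated by hand.\<close>

lemma wp_loop_free [simp]:
  "wp p n m v Skip Q s \<longleftrightarrow> Q 1 s"
  "wp p n m v (NAssign x k e) Q s \<longleftrightarrow> Q (1 + ncost k + ncost e) (nupd x (nval s k) (nval s e) s)"
  "wp p n m v (RAssign x k f) Q s \<longleftrightarrow> Q (1 + ncost k + rcost f) (rupd x (nval s k) (rval p s f) s)"
  "wp p n m v (Query x k i y) Q s \<longleftrightarrow> nval s i \<in> {1..n} \<and>
     Q (1 + ncost k + ncost i)
       (rupd x (nval s k) (v (nval s i) {j \<in> {1..m}. nmem s y j \<noteq> 0}) s)"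
  "wp p n m v (Seq c d) Q s \<longleftrightarrow>
     wp p n m v c (\<lambda>t. wp p n m v d (\<lambda>t'. Q (t + t'))) s"
  "wp p n m v (If b c d) Q s \<longleftrightarrow>
     (if bval p s b then wp p n m v c (\<lambda>t. Q (1 + bcost b + t)) s
      else wp p n m v d (\<lambda>t. Q (1 + bcost b + t)) s)"
  by (auto simp: wp_def exec_loop_free) blast

lemma wp_mono:
  assumes "wp p n m v c Q s" "\<And>t s'. Q t s' \<Longrightarrow> Q' t s'"
  shows "wp p n m v c Q' s"
  using assms by (auto simp: wp_def)

section \<open>Frame conditions from the sets of written variables\<close>

primrec nwrites :: "com \<Rightarrow> vname set" where
  "nwrites Skip = {}"
| "nwrites (NAssign x k e) = {x}"
| "nwrites (RAssign x k e) = {}"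
| "nwrites (Query x k i y) = {}"
| "nwrites (Seq c d) = nwrites c \<union> nwrites d"
| "nwrites (If b c d) = nwrites c \<union> nwrites d"
| "nwrites (While b c) = nwrites c"

primrec rwrites :: "com \<Rightarrow> vname set" where
  "rwrites Skip = {}"
| "rwrites (NAssign x k e) = {}"
| "rwrites (RAssign x k e) = {x}"
| "rwrites (Query x k i y) = {x}"
| "rwrites (Seq c d) = rwrites c \<union> rwrites d"
| "rwrites (If b c d) = rwrites c \<union> rwrites d"
| "rwrites (While b c) = rwrites c"

definition agree_off :: "vname set \<Rightarrow> vname set \<Rightarrow> store \<Rightarrow> store \<Rightarrow> bool" where
  "agree_off X Y s s' \<longleftrightarrow>
     (\<forall>x. x \<notin> X \<longrightarrow> nmem s' x = nmem s x) \<and> (\<forall>y. y \<notin> Y \<longrightarrow> rmem s' y = rmem s y)"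

lemma agree_offD:
  "agree_off X Y s s' \<Longrightarrow> x \<notin> X \<Longrightarrow> nmem s' x = nmem s x"
  "agree_off X Y s s' \<Longrightarrow> y \<notin> Y \<Longrightarrow> rmem s' y = rmem s y"
  by (auto simp: agree_off_def)

lemma agree_off_refl: "agree_off X Y s s"
  by (simp add: agree_off_def)

lemma agree_off_trans: "agree_off X Y s s' \<Longrightarrow> agree_off X Y s' s'' \<Longrightarrow> agree_off X Y s s''"
  by (simp add: agree_off_def)

lemma agree_off_mono:
  "agree_off X Y s s' \<Longrightarrow> X \<subseteq> X' \<Longrightarrow> Y \<subseteq> Y' \<Longrightarrow> agree_off X' Y' s s'"
  by (auto simp: agree_off_def)

lemma mem_upd [simp]:
  "nmem (nupd x k a s) y = (if x = y then (nmem s y)(k := a) else nmem s y)"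
  "rmem (nupd x k a s) = rmem s"
  "rmem (rupd x k c s) y = (if x = y then (rmem s y)(k := c) else rmem s y)"
  "nmem (rupd x k c s) = nmem s"
  by (auto simp: nupd_def rupd_def)

lemma exec_agree_off: "exec p n m v c s t s' \<Longrightarrow> agree_off (nwrites c) (rwrites c) s s'"
  by (induction rule: exec.induct) (auto simp: agree_off_def)

lemma wp_frame:
  assumes "wp p n m v c Q s"
  shows "wp p n m v c (\<lambda>t s'. Q t s' \<and> agree_off (nwrites c) (rwrites c) s s') s"
  using assms exec_agree_off unfolding wp_def by blast

text \<open>The index \<open>k\<close> of the invariant is the variant of the loop; it may depend on ghost state.\<close>

lemma wp_While:
  assumes "I k s"
    and "\<And>k s'. I k s' \<Longrightarrow> agree_off (nwrites c) (rwrites c) s s' \<Longrightarrow> bval p s' b \<Longrightarrow>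
           wp p n m v c (\<lambda>t s''. t \<le> T \<and> (\<exists>k'<k. I k' s'')) s'"
  shows "wp p n m v (While b c)
           (\<lambda>t s'. t \<le> (k + 1) * (1 + bcost b + T) \<and> (\<exists>k. I k s') \<and> \<not> bval p s' b) s"
proof -
  have "\<exists>t s''. exec p n m v (While b c) s' t s'' \<and> t \<le> (k + 1) * (1 + bcost b + T) \<and>
          (\<exists>k. I k s'') \<and> \<not> bval p s'' b"
    if "I k s'" "agree_off (nwrites c) (rwrites c) s s'" for s'
    using that
  proof (induction k arbitrary: s' rule: less_induct)
    case (less k)
    show ?case
    proof (cases "bval p s' b")
      case False
      then show ?thesis using less.prems exec.WhileFalse[of p s' b n m v c] by fastforce
    next
      case True
      then obtain t1 s1 k' where 1: "exec p n m v c s' t1 s1" "t1 \<le> T" "k' < k" "I k' s1"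
        using assms(2)[OF less.prems True] by (auto simp: wp_def)
      have "agree_off (nwrites c) (rwrites c) s s1"
        using agree_off_trans[OF less.prems(2) exec_agree_off[OF 1(1)]] .
      then obtain t2 s2 where 2: "exec p n m v (While b c) s1 t2 s2"
          "t2 \<le> (k' + 1) * (1 + bcost b + T)" "\<exists>k. I k s2" "\<not> bval p s2 b"
        using less.IH[OF 1(3,4)] by blast
      have "(k' + 1) * (1 + bcost b + T) \<le> k * (1 + bcost b + T)"
        using 1(3) by (intro mult_right_mono) auto
      then have "1 + bcost b + t1 + t2 \<le> (k + 1) * (1 + bcost b + T)" using 1 2 by simp
      then show ?thesis using exec.WhileTrue[OF True 1(1) 2(1)] 2 by blast
    qed
  qed
  then show ?thesis using assms(1) agree_off_refl unfolding wp_def by blast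
qed

abbreviation NV :: "vname \<Rightarrow> nexp" where "NV x \<equiv> NGet x (NConst 0)"
abbreviation RV :: "vname \<Rightarrow> rexp" where "RV x \<equiv> RGet x (NConst 0)"

section \<open>Counting loops\<close>

definition For :: "vname \<Rightarrow> nat \<Rightarrow> vname \<Rightarrow> com \<Rightarrow> com" where
  "For x lo y c = Seq (NAssign x (NConst 0) (NConst lo))
     (While (BNot (NLess (NV y) (NV x)))
        (Seq c (NAssign x (NConst 0) (NPlus (NV x) (NConst 1)))))"

lemma writes_For [simp]:
  "nwrites (For x lo y c) = insert x (nwrites c)" "rwrites (For x lo y c) = rwrites c"
  by (auto simp: For_def)

text \<open>\<open>I k\<close> describes the store just before the body runs with index
  \<open>k\<close>, so \<open>I (Suc h)\<close> is the final result. Of the overhead 15 per round, 7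
  units pay for the test, 6 for the increment, and 2 absorb the initial assignment of cost
  3.\<close>

lemma wp_For:
  assumes x: "x \<notin> nwrites c" "y \<notin> nwrites c" "x \<noteq> y" and h: "nmem s y 0 = h" "lo \<le> Suc h"
    and I0: "I lo (nupd x 0 lo s)"
    and step: "\<And>k s'. lo \<le> k \<Longrightarrow> k \<le> h \<Longrightarrow> nmem s' x 0 = k \<Longrightarrow> I k s' \<Longrightarrow>
           agree_off (insert x (nwrites c)) (rwrites c) s s' \<Longrightarrow>
           wp p n m v c (\<lambda>t s''. t \<le> T \<and> I (Suc k) (nupd x 0 (Suc k) s'')) s'"
  shows "wp p n m v (For x lo y c)
           (\<lambda>t s'. t \<le> (h + 2) * (T + 15) \<and> I (Suc h) s' \<and>
              agree_off (insert x (nwrites c)) (rwrites c) s s') s"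
proof -
  let ?J = "\<lambda>k s'. \<exists>i. lo \<le> i \<and> i \<le> Suc h \<and> k = Suc h - i \<and> nmem s' x 0 = i \<and> I i s' \<and>
              agree_off (insert x (nwrites c)) (rwrites c) s s'"
  let ?b = "BNot (NLess (NV y) (NV x))"
  let ?c = "Seq c (NAssign x (NConst 0) (NPlus (NV x) (NConst 1)))"
  let ?s = "nupd x 0 lo s"
  have ag: "agree_off (insert x (nwrites c)) (rwrites c) s ?s" by (simp add: agree_off_def)
  have "wp p n m v (While ?b ?c)
      (\<lambda>t s'. t \<le> ((Suc h - lo) + 1) * (1 + bcost ?b + (T + 6)) \<and> (\<exists>k. ?J k s') \<and> \<not> bval p s' ?b) ?s"
  proof (rule wp_While[where I = ?J])
    show "?J (Suc h - lo) ?s" using I0 h(2) ag by auto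
  next
    fix k s'
    assume "?J k s'" and b: "bval p s' ?b"
    then obtain i where i: "lo \<le> i" "i \<le> Suc h" "k = Suc h - i" "nmem s' x 0 = i" "I i s'"
      "agree_off (insert x (nwrites c)) (rwrites c) s s'" by auto
    have "nmem s' y 0 = h" using agree_offD(1)[OF i(6), of y] x h by auto
    with b i have "i \<le> h" by simp
    have "wp p n m v c (\<lambda>t s''. (t \<le> T \<and> I (Suc i) (nupd x 0 (Suc i) s'')) \<and>
            agree_off (nwrites c) (rwrites c) s' s'') s'"
      by (rule wp_frame, rule step) (use i \<open>i \<le> h\<close> in auto)
    then have "wp p n m v c (\<lambda>t s''. t + 6 \<le> T + 6 \<and> ?J (k - 1) (nupd x 0 (Suc (nmem s'' x 0)) s'') \<and> k - 1 < k) s'"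
    proof (rule wp_mono)
      fix t s''
      assume *: "(t \<le> T \<and> I (Suc i) (nupd x 0 (Suc i) s'')) \<and> agree_off (nwrites c) (rwrites c) s' s''"
      then have "nmem s'' x 0 = i" using agree_offD(1)[of _ _ s' s'' x] x i by auto
      moreover have "agree_off (insert x (nwrites c)) (rwrites c) s (nupd x 0 (Suc i) s'')"
        using * i(6) by (auto simp: agree_off_def)
      ultimately show "t + 6 \<le> T + 6 \<and> ?J (k - 1) (nupd x 0 (Suc (nmem s'' x 0)) s'') \<and> k - 1 < k"
        using * i \<open>i \<le> h\<close> by auto
    qed
    then show "wp p n m v ?c (\<lambda>t s''. t \<le> T + 6 \<and> (\<exists>k'<k. ?J k' s'')) s'"
      by (auto elim!: wp_mono intro!: exI[of _ "k - 1"])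
  qed
  then have "wp p n m v (While ?b ?c)
      (\<lambda>t s'. 3 + t \<le> (h + 2) * (T + 15) \<and> I (Suc h) s' \<and>
          agree_off (insert x (nwrites c)) (rwrites c) s s') ?s"
  proof (rule wp_mono)
    fix t s'
    assume *: "t \<le> ((Suc h - lo) + 1) * (1 + bcost ?b + (T + 6)) \<and> (\<exists>k. ?J k s') \<and> \<not> bval p s' ?b"
    then obtain i where i: "i \<le> Suc h" "nmem s' x 0 = i" "I i s'"
      "agree_off (insert x (nwrites c)) (rwrites c) s s'" by auto
    have "nmem s' y 0 = h" using agree_offD(1)[OF i(4), of y] x h by auto
    with * i have "i = Suc h" by simp
    have "t \<le> (Suc h - lo + 1) * (1 + bcost ?b + (T + 6))" using * by blast
    also have "\<dots> \<le> (h + 2) * (T + 13)" by (intro mult_mono) auto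
    finally have "t \<le> (h + 2) * (T + 13)" .
    then have "3 + t \<le> 2 * (h + 2) + (h + 2) * (T + 13)" by (intro add_mono) auto
    also have "\<dots> = (h + 2) * (T + 15)" by (simp add: algebra_simps)
    finally have "3 + t \<le> (h + 2) * (T + 15)" .
    then show "3 + t \<le> (h + 2) * (T + 15) \<and> I (Suc h) s' \<and>
        agree_off (insert x (nwrites c)) (rwrites c) s s'"
      using i unfolding \<open>i = Suc h\<close> by (intro conjI)
  qed
  then show ?thesis by (simp add: For_def)
qed

section \<open>The program\<close>

text \<open>The array \<open>y\<close> is zero except around the query, where a single entry 1
  selects the bundle \<open>{b}\<close>. The guard on \<open>used\<close> also keeps the query
  legal: during a search every tree column has an owner, while an unowned column would name the
  agent 0 and abort the run.\<close>

definition scan_edge :: "(rexp \<Rightarrow> rexp \<Rightarrow> rexp) \<Rightarrow> (rexp \<Rightarrow> rexp) \<Rightarrow> com" where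
  "scan_edge sub price =
     If (BAnd (NLess (NConst 0) (NGet ''used'' (NV ''a'')))
              (BNot (NLess (NConst 0) (NGet ''used'' (NV ''b'')))))
       (Seq (NAssign ''y'' (NV ''b'') (NConst 1))
       (Seq (Query ''w'' (NConst 0) (NGet ''owner'' (NV ''a'')) ''y'')
       (Seq (NAssign ''y'' (NV ''b'') (NConst 0))
       (If (RLess (RConst 0) (RV ''w''))
         (Seq (RAssign ''d'' (NConst 0)
                (sub (sub (price (RV ''w'')) (RGet ''u'' (NGet ''owner'' (NV ''a''))))
                  (RGet ''v'' (NV ''b''))))
         (If (BAnd (NLess (NConst 0) (NV ''best'')) (BNot (RLess (RV ''d'') (RV ''delta''))))
           Skip
           (Seq (RAssign ''delta'' (NConst 0) (RV ''d''))
           (Seq (NAssign ''best'' (NConst 0) (NV ''b''))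
                (NAssign ''from'' (NConst 0) (NV ''a''))))))
         Skip))))
       Skip"

text \<open>All pairs are scanned afresh at every growth step, without minima stored per column.
  This costs a factor of about \<open>m\<close> against the cubic Hungarian method, but no stored
  slacks have to be kept correct under the dual shifts.\<close>

definition search :: "(rexp \<Rightarrow> rexp \<Rightarrow> rexp) \<Rightarrow> (rexp \<Rightarrow> rexp) \<Rightarrow> com" where
  "search sub price =
     Seq (NAssign ''best'' (NConst 0) (NConst 0))
       (For ''a'' 0 ''m'' (For ''b'' 1 ''m'' (scan_edge sub price)))"

definition shift :: "(rexp \<Rightarrow> rexp \<Rightarrow> rexp) \<Rightarrow> (rexp \<Rightarrow> rexp \<Rightarrow> rexp) \<Rightarrow> com" where
  "shift add sub =
     For ''a'' 0 ''m''
       (If (NLess (NConst 0) (NGet ''used'' (NV ''a'')))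
         (Seq (RAssign ''u'' (NGet ''owner'' (NV ''a''))
                (add (RGet ''u'' (NGet ''owner'' (NV ''a''))) (RV ''delta'')))
              (RAssign ''v'' (NV ''a'') (sub (RGet ''v'' (NV ''a'')) (RV ''delta''))))
         Skip)"

definition grow ::
    "(rexp \<Rightarrow> rexp \<Rightarrow> rexp) \<Rightarrow> (rexp \<Rightarrow> rexp \<Rightarrow> rexp) \<Rightarrow> (rexp \<Rightarrow> rexp) \<Rightarrow> com" where
  "grow add sub price =
     Seq (search sub price)
       (If (NLess (NConst 0) (NV ''best''))
         (Seq (shift add sub)
         (Seq (NAssign ''way'' (NV ''best'') (NV ''from''))
         (Seq (NAssign ''cur'' (NConst 0) (NV ''best''))
              (NAssign ''used'' (NV ''best'') (NConst 1)))))
         (NAssign ''i'' (NConst 0) (NPlus (NV ''n'') (NConst 1))))"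

text \<open>The language has no jumps. A stuck search sets \<open>i\<close> to \<open>n + 1\<close>;
  this test then fails, so the search loop ends and the augmentation is skipped, and the outer test
  that \<open>i\<close> is below \<open>n\<close> fails as well.\<close>

definition alive :: bexp where
  "alive = BNot (NLess (NV ''n'') (NV ''i''))"

definition augment :: com where
  "augment =
     While (BAnd (NLess (NConst 0) (NV ''cur'')) alive)
       (Seq (NAssign ''owner'' (NV ''cur'') (NGet ''owner'' (NGet ''way'' (NV ''cur''))))
            (NAssign ''cur'' (NConst 0) (NGet ''way'' (NV ''cur''))))"

definition start_phase :: "rexp \<Rightarrow> com" where
  "start_phase nought =
     Seq (NAssign ''i'' (NConst 0) (NPlus (NV ''i'') (NConst 1)))
     (Seq (NAssign ''owner'' (NConst 0) (NV ''i''))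
     (Seq (RAssign ''u'' (NV ''i'') nought)
     (Seq (NAssign ''cur'' (NConst 0) (NConst 0))
     (Seq (For ''a'' 0 ''m'' (NAssign ''used'' (NV ''a'') (NConst 0)))
          (NAssign ''used'' (NConst 0) (NConst 1))))))"

definition phase ::
    "rexp \<Rightarrow> (rexp \<Rightarrow> rexp \<Rightarrow> rexp) \<Rightarrow> (rexp \<Rightarrow> rexp \<Rightarrow> rexp) \<Rightarrow> (rexp \<Rightarrow> rexp) \<Rightarrow> com" where
  "phase nought add sub price =
     Seq (start_phase nought)
     (Seq (While (BAnd (NLess (NConst 0) (NGet ''owner'' (NV ''cur''))) alive)
             (grow add sub price))
          augment)"

text \<open>The array \<open>v\<close> is initialized explicitly because the initial memory content
  0 need not encode the potential 0; for p = 0 the encoding is 1. Agent 1 receives all goods left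
  without an owner, so an allocation results after a stuck search as well.\<close>

definition matching_program ::
    "rexp \<Rightarrow> (rexp \<Rightarrow> rexp \<Rightarrow> rexp) \<Rightarrow> (rexp \<Rightarrow> rexp \<Rightarrow> rexp) \<Rightarrow> (rexp \<Rightarrow> rexp) \<Rightarrow> com" where
  "matching_program nought add sub price =
     Seq (For ''a'' 0 ''m'' (RAssign ''v'' (NV ''a'') nought))
     (Seq (While (NLess (NV ''i'') (NV ''n'')) (phase nought add sub price))
          (For ''b'' 1 ''m''
            (If (NLess (NConst 0) (NGet ''owner'' (NV ''b''))) Skip
              (NAssign ''owner'' (NV ''b'') (NConst 1)))))"

text \<open>Potentials and prices are stored through a strictly monotone encoding \<open>E\<close> of the reals:
  the identity for \<open>p < 0\<close>, and the exponential function for \<open>p = 0\<close>, where the machine has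
  no logarithm and sums of logarithms are computed as products.\<close>

locale encoded_prices =
  fixes p :: real and E :: "real \<Rightarrow> real" and \<kappa> :: "real \<Rightarrow> real"
    and nought :: rexp and add sub :: "rexp \<Rightarrow> rexp \<Rightarrow> rexp" and price :: "rexp \<Rightarrow> rexp"
  assumes E_less: "E x < E y \<longleftrightarrow> x < y"
    and rval_nought: "rval p s nought = E 0" and rcost_nought: "rcost nought = 1"
    and rval_add: "rval p s e = E x \<Longrightarrow> rval p s f = E y \<Longrightarrow> rval p s (add e f) = E (x + y)"
    and rcost_add: "rcost (add e f) = 1 + rcost e + rcost f"
    and rval_sub: "rval p s e = E x \<Longrightarrow> rval p s f = E y \<Longrightarrow> rval p s (sub e f) = E (x - y)"
    and rcost_sub: "rcost (sub e f) = 1 + rcost e + rcost f"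
    and rval_price: "0 < rval p s e \<Longrightarrow> rval p s (price e) = E (\<kappa> (rval p s e))"
    and rcost_price: "rcost (price e) \<le> 2 + rcost e"

section \<open>Total correctness and running time, from the innermost loop outwards\<close>

locale matching_run = encoded_prices +
  fixes n m :: nat and v :: "nat \<Rightarrow> nat set \<Rightarrow> real"
  assumes n_le_m: "n \<le> m"
begin

abbreviation accepts :: "nat \<Rightarrow> nat \<Rightarrow> bool" where "accepts i j \<equiv> 0 < v i {j}"

sublocale matching_problem m "\<lambda>i j. 0 < v i {j}" "\<lambda>i j. \<kappa> (v i {j})" .

definition saturating :: "(nat \<Rightarrow> nat) \<Rightarrow> bool" where
  "saturating \<sigma> \<longleftrightarrow> inj_on \<sigma> {1..n} \<and> (\<forall>i\<in>{1..n}. \<sigma> i \<in> {1..m} \<and> accepts i (\<sigma> i))"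

definition slack ::
    "(nat \<Rightarrow> nat) \<Rightarrow> (nat \<Rightarrow> real) \<Rightarrow> (nat \<Rightarrow> real) \<Rightarrow> nat \<times> nat \<Rightarrow> real" where
  "slack own U V = (\<lambda>(a, b). \<kappa> (v (own a) {b}) - U (own a) - V b)"

definition leaving :: "(nat \<Rightarrow> nat) \<Rightarrow> nat set \<Rightarrow> (nat \<times> nat) set" where
  "leaving own R = {(a, b). a \<in> R \<and> b \<notin> R \<and> b \<in> {1..m} \<and> accepts (own a) b}"

text \<open>Column \<open>0\<close> is included although \<open>V 0\<close> enters no tightness or
  feasibility condition: the dual shift treats the dummy column like every other tree
  column.\<close>

definition encodes :: "store \<Rightarrow> nat \<Rightarrow> (nat \<Rightarrow> real) \<Rightarrow> (nat \<Rightarrow> real) \<Rightarrow> bool" where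
  "encodes s k U V \<longleftrightarrow>
     (\<forall>i\<in>{1..k}. rmem s ''u'' i = E (U i)) \<and> (\<forall>j\<le>m. rmem s ''v'' j = E (V j))"

definition sizes :: "store \<Rightarrow> bool" where
  "sizes s \<longleftrightarrow> nmem s ''n'' 0 = n \<and> nmem s ''m'' 0 = m"

definition used_set :: "store \<Rightarrow> nat set" where
  "used_set s = {j. j \<le> m \<and> nmem s ''used'' j \<noteq> 0}"

text \<open>Goods are numbered from 1, so \<open>best = 0\<close> records that no edge has been found.\<close>

definition best_in :: "store \<Rightarrow> (nat \<times> nat \<Rightarrow> real) \<Rightarrow> (nat \<times> nat) set \<Rightarrow> bool" where
  "best_in s sl X \<longleftrightarrow>
     (let x = (nmem s ''from'' 0, nmem s ''best'' 0) in
      if nmem s ''best'' 0 = 0 then X = {}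
      else x \<in> X \<and> rmem s ''delta'' 0 = E (sl x) \<and> (\<forall>x'\<in>X. sl x \<le> sl x'))"

text \<open>This collects what an edge scan reads and never writes, so it holds throughout the
  search. The last two conditions make every query to the owner of a tree column legal.\<close>

definition search_context ::
    "store \<Rightarrow> nat \<Rightarrow> (nat \<Rightarrow> nat) \<Rightarrow> nat set \<Rightarrow> (nat \<Rightarrow> real) \<Rightarrow> (nat \<Rightarrow> real) \<Rightarrow> bool" where
  "search_context s k own R U V \<longleftrightarrow>
     sizes s \<and> used_set s = R \<and> nmem s ''owner'' = own \<and> encodes s k U V \<and> k \<le> n \<and>
     (\<forall>j\<in>R. own j \<in> {1..k})"

lemma E_le: "E x \<le> E y \<longleftrightarrow> x \<le> y"
  using E_less[of y x] by (simp add: not_less[symmetric])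

lemma best_in_nupd [simp]:
  "x \<noteq> ''best'' \<Longrightarrow> x \<noteq> ''from'' \<Longrightarrow> best_in (nupd x i k s) sl X = best_in s sl X"
  by (simp add: best_in_def)

lemma writes_scan_edge [simp]:
  "nwrites (scan_edge sub price) = {''y'', ''best'', ''from''}"
  "rwrites (scan_edge sub price) = {''w'', ''d'', ''delta''}"
  by (auto simp: scan_edge_def)

lemma search_context_agree:
  assumes "search_context s k own R U V"
    and "agree_off {''a'', ''b'', ''y'', ''best'', ''from''} {''w'', ''d'', ''delta''} s s'"
  shows "search_context s' k own R U V"
proof -
  note ag = agree_offD[OF assms(2)]
  show ?thesis
    using assms(1) by (simp add: search_context_def sizes_def used_set_def encodes_def ag)
qed

lemma wp_scan_edge:
  assumes ctx: "search_context s k own R U V" and y: "\<forall>j. nmem s ''y'' j = 0"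
    and ab: "nmem s ''a'' 0 = a" "nmem s ''b'' 0 = b" "a \<le> m" "b \<in> {1..m}"
    and best: "best_in s (slack own U V) X" and "\<And>x. x \<in> X \<Longrightarrow> snd x \<noteq> 0"
  shows "wp p n m v (scan_edge sub price)
     (\<lambda>t s'. t \<le> 80 \<and> (\<forall>j. nmem s' ''y'' j = 0) \<and>
        best_in s' (slack own U V) (X \<union> leaving own R \<inter> {(a, b)})) s"
proof (cases "a \<in> R \<and> b \<notin> R")
  case False
  then have "leaving own R \<inter> {(a, b)} = {}" by (auto simp: leaving_def)
  moreover have "\<not> (nmem s ''used'' a \<noteq> 0 \<and> nmem s ''used'' b = 0)"
    using False ctx ab by (auto simp: search_context_def used_set_def)
  ultimately show ?thesis using y best ab by (auto simp: scan_edge_def)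
next
  case True
  then have used: "nmem s ''used'' a \<noteq> 0" "nmem s ''used'' b = 0"
    using ctx ab by (auto simp: search_context_def used_set_def)
  have own: "own a \<in> {1..k}" "own a \<in> {1..n}" "nmem s ''owner'' = own"
    using ctx True by (auto simp: search_context_def)
  have single: "{j. Suc 0 \<le> j \<and> j \<le> m \<and> j = b} = {b}" using ab by auto
  show ?thesis
  proof (cases "accepts (own a) b")
    case acc: False
    then have "leaving own R \<inter> {(a, b)} = {}" by (auto simp: leaving_def)
    then show ?thesis
      using y best ab used own acc by (simp add: scan_edge_def single best_in_def Let_def)
  next
    case acc: True
    then have L: "leaving own R \<inter> {(a, b)} = {(a, b)}" using True ab by (auto simp: leaving_def)
    have u: "rmem s ''u'' (own a) = E (U (own a))" "rmem s ''v'' b = E (V b)"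
      using ctx own ab by (auto simp: search_context_def encodes_def)
    let ?e = "sub (sub (price (RV ''w'')) (RGet ''u'' (NGet ''owner'' (NV ''a''))))
                  (RGet ''v'' (NV ''b''))"
    have val: "rval p s' ?e = E (slack own U V (a, b))"
      if "rmem s' ''w'' 0 = v (own a) {b}" "rmem s' ''u'' = rmem s ''u''" "rmem s' ''v'' = rmem s ''v''"
        "nmem s' ''owner'' = own" "nmem s' ''a'' 0 = a" "nmem s' ''b'' 0 = b" for s'
      unfolding slack_def prod.case
      using that acc u rval_price[of s' "RV ''w''"]
      by (intro rval_sub) auto
    have cost: "rcost ?e \<le> 15"
      using rcost_price[of "RV ''w''"] by (simp add: rcost_sub)
    let ?x = "(nmem s ''from'' 0, nmem s ''best'' 0)"
    have key: "\<forall>x'\<in>X. slack own U V (a, b) \<le> slack own U V x'"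
      if "0 < nmem s ''best'' 0" "\<not> slack own U V ?x \<le> slack own U V (a, b)"
    proof
      fix x' assume "x' \<in> X"
      then have "slack own U V ?x \<le> slack own U V x'"
        using best that by (simp add: best_in_def Let_def)
      then show "slack own U V (a, b) \<le> slack own U V x'" using that by linarith
    qed
    show ?thesis
      using y best ab used own acc cost u key
      by (simp add: scan_edge_def single L best_in_def Let_def val E_le not_less)
  qed
qed

lemma wp_search:
  assumes ctx: "search_context s k own R U V" and y: "\<forall>j. nmem s ''y'' j = 0"
  shows "wp p n m v (search sub price)
     (\<lambda>t s'. t \<le> 120 * (m + 2)\<^sup>2 \<and> (\<forall>j. nmem s' ''y'' j = 0) \<and>
        best_in s' (slack own U V) (leaving own R) \<and>
        agree_off {''a'', ''b'', ''y'', ''best'', ''from''} {''w'', ''d'', ''delta''} s s') s"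
proof -
  let ?sl = "slack own U V"
  \<comment> \<open>The leaving edges that precede \<open>(a, b)\<close> in the lexicographic order
    of the scan.\<close>
  let ?L = "\<lambda>a b. leaving own R \<inter> {(a', b'). a' < a \<or> a' = a \<and> b' < b}"
  let ?I = "\<lambda>a b s'. (\<forall>j. nmem s' ''y'' j = 0) \<and> best_in s' ?sl (?L a b)"
  let ?X = "{''a'', ''b'', ''y'', ''best'', ''from''}" and ?Y = "{''w'', ''d'', ''delta''}"
  define s0 where "s0 = nupd ''best'' 0 0 s"
  have ag0: "agree_off ?X ?Y s s0" by (simp add: agree_off_def s0_def)
  have sz: "nmem s0 ''m'' 0 = m" using ctx by (simp add: s0_def search_context_def sizes_def)
  \<comment> \<open>A row may start at 1, since no leaving edge ends in column \<open>0\<close>; the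
    end of a row is the beginning of the next.\<close>
  have L1: "?L a (Suc 0) = ?L a 0" "?L a (Suc m) = ?L (Suc a) 0" for a
    by (auto simp: leaving_def less_Suc_eq)
  have L2: "?L a b \<union> leaving own R \<inter> {(a, b)} = ?L a (Suc b)" for a b
    by auto
  have "wp p n m v (For ''a'' 0 ''m'' (For ''b'' 1 ''m'' (scan_edge sub price)))
      (\<lambda>t s'. t \<le> (m + 2) * ((m + 2) * (80 + 15) + 15) \<and> ?I (Suc m) 0 s' \<and>
         agree_off (insert ''a'' (nwrites (For ''b'' 1 ''m'' (scan_edge sub price))))
           (rwrites (For ''b'' 1 ''m'' (scan_edge sub price))) s0 s') s0"
  proof (rule wp_For[where I = "\<lambda>a. ?I a 0"])
    show "?I 0 0 (nupd ''a'' 0 0 s0)" using y by (simp add: s0_def best_in_def)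
  next
    fix a s1
    assume a: "a \<le> m" "nmem s1 ''a'' 0 = a" and I: "?I a 0 s1"
      and ag: "agree_off (insert ''a'' (nwrites (For ''b'' 1 ''m'' (scan_edge sub price))))
           (rwrites (For ''b'' 1 ''m'' (scan_edge sub price))) s0 s1"
    have ag1: "agree_off ?X ?Y s s1"
      using agree_off_trans[OF ag0 agree_off_mono[OF ag]] by auto
    have "wp p n m v (For ''b'' 1 ''m'' (scan_edge sub price))
      (\<lambda>t s'. t \<le> (m + 2) * (80 + 15) \<and> ?I a (Suc m) s' \<and>
         agree_off (insert ''b'' (nwrites (scan_edge sub price)))
           (rwrites (scan_edge sub price)) s1 s') s1"
    proof (rule wp_For[where I = "?I a"])
      show "nmem s1 ''m'' 0 = m" using sz agree_offD(1)[OF ag, of "''m''"] by simp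
      show "?I a 1 (nupd ''b'' 0 1 s1)" using I unfolding One_nat_def L1 by simp
    next
      fix b s2
      assume b: "1 \<le> b" "b \<le> m" "nmem s2 ''b'' 0 = b" and I: "?I a b s2"
        and ag: "agree_off (insert ''b'' (nwrites (scan_edge sub price)))
           (rwrites (scan_edge sub price)) s1 s2"
      have ag2: "agree_off ?X ?Y s s2"
        using agree_off_trans[OF ag1 agree_off_mono[OF ag]] by auto
      have "nmem s2 ''a'' 0 = a" using a agree_offD(1)[OF ag, of "''a''"] by simp
      then have "wp p n m v (scan_edge sub price)
         (\<lambda>t s'. t \<le> 80 \<and> (\<forall>j. nmem s' ''y'' j = 0) \<and>
            best_in s' ?sl (?L a b \<union> leaving own R \<inter> {(a, b)})) s2"
        using a b I
        by (intro wp_scan_edge[OF search_context_agree[OF ctx ag2]]) (auto simp: leaving_def)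
      then show "wp p n m v (scan_edge sub price)
         (\<lambda>t s'. t \<le> 80 \<and> ?I a (Suc b) (nupd ''b'' 0 (Suc b) s')) s2"
        unfolding L2 by simp
    qed auto
    then show "wp p n m v (For ''b'' 1 ''m'' (scan_edge sub price))
      (\<lambda>t s'. t \<le> (m + 2) * (80 + 15) \<and> ?I (Suc a) 0 (nupd ''a'' 0 (Suc a) s')) s1"
      unfolding L1 by (rule wp_mono) simp
  qed (use sz in auto)
  moreover have "?L (Suc m) 0 = leaving own R" if "R \<subseteq> {..m}"
    using that by (auto simp: leaving_def)
  moreover have "R \<subseteq> {..m}" using ctx by (auto simp: search_context_def used_set_def)
  moreover have "3 + (m + 2) * ((m + 2) * (80 + 15) + 15) \<le> 120 * (m + 2)\<^sup>2"
    by (simp add: power2_eq_square algebra_simps)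
  ultimately have "wp p n m v (For ''a'' 0 ''m'' (For ''b'' 1 ''m'' (scan_edge sub price)))
      (\<lambda>t s'. 3 + t \<le> 120 * (m + 2)\<^sup>2 \<and> (\<forall>j. nmem s' ''y'' j = 0) \<and>
        best_in s' ?sl (leaving own R) \<and> agree_off ?X ?Y s s') s0"
    by (auto elim!: wp_mono agree_off_trans[OF ag0 agree_off_mono])
  then show ?thesis by (simp add: search_def s0_def numeral_3_eq_3)
qed

text \<open>The loop runs over columns but updates potentials of agents. Injectivity of
  \<open>own\<close> on the tree ensures that each tree agent is raised exactly once, so after the
  columns below \<open>a\<close> exactly their owners have been shifted.\<close>

lemma wp_shift:
  assumes ctx: "search_context s k own R U V" and inj: "inj_on own R"
    and d: "rmem s ''delta'' 0 = E d"
  shows "wp p n m v (shift add sub)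
     (\<lambda>t s'. t \<le> 50 * (m + 2) \<and>
        encodes s' k (\<lambda>i. if i \<in> own ` R then U i + d else U i)
          (\<lambda>j. if j \<in> R then V j - d else V j) \<and>
        agree_off {''a''} {''u'', ''v''} s s') s"
proof -
  let ?U = "\<lambda>a i. if i \<in> own ` (R \<inter> {..<a}) then U i + d else U i"
  let ?V = "\<lambda>a j. if j \<in> R \<inter> {..<a} then V j - d else V j"
  let ?c = "If (NLess (NConst 0) (NGet ''used'' (NV ''a'')))
         (Seq (RAssign ''u'' (NGet ''owner'' (NV ''a''))
                (add (RGet ''u'' (NGet ''owner'' (NV ''a''))) (RV ''delta'')))
              (RAssign ''v'' (NV ''a'') (sub (RGet ''v'' (NV ''a'')) (RV ''delta''))))
         Skip"
  have R: "R \<subseteq> {..m}" "R \<inter> {..<Suc m} = R"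
    using ctx by (auto simp: search_context_def used_set_def)
  have "wp p n m v (For ''a'' 0 ''m'' ?c)
     (\<lambda>t s'. t \<le> (m + 2) * (35 + 15) \<and> encodes s' k (?U (Suc m)) (?V (Suc m)) \<and>
        agree_off (insert ''a'' (nwrites ?c)) (rwrites ?c) s s') s"
  proof (rule wp_For[where I = "\<lambda>a s'. encodes s' k (?U a) (?V a)"])
    show "encodes (nupd ''a'' 0 0 s) k (?U 0) (?V 0)" "nmem s ''m'' 0 = m"
      using ctx by (auto simp: search_context_def encodes_def sizes_def)
  next
    fix a s1
    assume a: "a \<le> m" "nmem s1 ''a'' 0 = a" and I: "encodes s1 k (?U a) (?V a)"
      and ag: "agree_off (insert ''a'' (nwrites ?c)) (rwrites ?c) s s1"
    have mem: "nmem s1 ''used'' = nmem s ''used''" "nmem s1 ''owner'' = own" "rmem s1 ''delta'' 0 = E d"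
      using agree_offD[OF ag] ctx d by (auto simp: search_context_def)
    show "wp p n m v ?c
       (\<lambda>t s'. t \<le> 35 \<and> encodes (nupd ''a'' 0 (Suc a) s') k (?U (Suc a)) (?V (Suc a))) s1"
    proof (cases "a \<in> R")
      case False
      then have "R \<inter> {..<Suc a} = R \<inter> {..<a}" by (auto simp: less_Suc_eq)
      moreover have "nmem s ''used'' a = 0"
        using False a ctx by (auto simp: search_context_def used_set_def)
      ultimately show ?thesis using I a mem by (simp add: encodes_def)
    next
      case True
      then have 1: "R \<inter> {..<Suc a} = insert a (R \<inter> {..<a})" by (auto simp: less_Suc_eq)
      have own: "own a \<in> {1..k}" "0 < nmem s ''used'' a"
        using True ctx by (auto simp: search_context_def used_set_def)
      have 2: "own a \<notin> own ` (R \<inter> {..<a})" using inj True by (auto dest: inj_onD)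
      have u: "rmem s1 ''u'' (own a) = E (U (own a))" "rmem s1 ''v'' a = E (V a)"
        using I own(1) a(1) 2 unfolding encodes_def by auto
      have 3: "rval p s1 (add (RGet ''u'' (NGet ''owner'' (NV ''a''))) (RV ''delta'')) = E (U (own a) + d)"
        using u a mem by (intro rval_add) auto
      have 4: "rval p (rupd ''u'' (own a) x s1) (sub (RGet ''v'' (NV ''a'')) (RV ''delta'')) = E (V a - d)" for x
        using u a mem by (intro rval_sub) auto
      show ?thesis
        using I a mem own 2 by (auto simp: encodes_def 1 3 4 rcost_add rcost_sub)
    qed
  qed auto
  then show ?thesis
    unfolding R(2) shift_def
    by (auto elim!: wp_mono agree_off_mono simp: algebra_simps)
qed

section \<open>Invariants of the phases, linking the store to the matching states\<close>

definition ready :: "store \<Rightarrow> bool" where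
  "ready s \<longleftrightarrow> sizes s \<and> (\<forall>j. nmem s ''y'' j = 0)"

definition searching ::
    "store \<Rightarrow> nat \<Rightarrow> nat set \<Rightarrow> (nat \<Rightarrow> nat) \<Rightarrow> (nat \<Rightarrow> real) \<Rightarrow> (nat \<Rightarrow> real) \<Rightarrow> bool" where
  "searching s k R r U V \<longleftrightarrow>
     ready s \<and> nmem s ''i'' 0 = k \<and> k \<le> n \<and> used_set s = R \<and> encodes s k U V \<and>
     search_state k R (nmem s ''cur'' 0) (nmem s ''owner'') (nmem s ''way'') r U V"

text \<open>What is kept of a stuck search: the owners are still legal or 0, so the default owner
  completes them to an allocation, and there is no saturating assignment to compete with.\<close>

definition failed :: "store \<Rightarrow> bool" where
  "failed s \<longleftrightarrow>
     ready s \<and> nmem s ''i'' 0 = Suc n \<and> (\<forall>j\<in>{1..m}. nmem s ''owner'' j \<le> n) \<and>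
     \<not> (\<exists>\<sigma>. saturating \<sigma>)"

definition matched_up_to :: "store \<Rightarrow> nat \<Rightarrow> bool" where
  "matched_up_to s k \<longleftrightarrow>
     ready s \<and> nmem s ''i'' 0 = k \<and> k \<le> n \<and>
     (\<exists>U V. base_state k (nmem s ''owner'') U V \<and> encodes s k U V)"

lemma tight_matching_owner_le:
  assumes "tight_matching k h own U V" "j \<le> m" "j \<noteq> h"
  shows "own j \<le> k"
proof (cases "own j = 0")
  case False
  then have "j \<in> matched h own" using assms by (simp add: matched_def)
  then show ?thesis using assms(1) by (auto simp: tight_matching_def dest: bij_betwE)
qed simp

lemma wp_grow:
  assumes S: "searching s k R r U V" and cur: "nmem s ''owner'' (nmem s ''cur'' 0) \<noteq> 0"
  shows "wp p n m v (grow add sub price)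
     (\<lambda>t s'. t \<le> 200 * (m + 2)\<^sup>2 \<and>
        (failed s' \<or> (\<exists>R' r' U' V'. searching s' k R' r' U' V' \<and> card R < card R'))) s"
proof -
  define own way where "own = nmem s ''owner''" and "way = nmem s ''way''"
  have st: "search_state k R (nmem s ''cur'' 0) own way r U V" and rd: "ready s"
    and k: "nmem s ''i'' 0 = k" "k \<le> n"
    using S by (auto simp: searching_def own_def way_def)
  have ctx: "search_context s k own R U V"
    using S cur search_state_owner[OF st] unfolding search_context_def searching_def ready_def own_def
    by auto
  have R: "finite R" "R \<subseteq> {..m}" "inj_on own R"
  proof -
    show "R \<subseteq> {..m}" using ctx by (auto simp: search_context_def used_set_def)
    then show "finite R" by (rule finite_subset) simp
    have "R \<subseteq> matched (Suc m) own"
      using ctx \<open>R \<subseteq> {..m}\<close> by (force simp: search_context_def matched_def)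
    then show "inj_on own R"
      using st by (auto simp: search_state_def tight_matching_def bij_betw_def intro: inj_on_subset)
  qed
  let ?grow = "If (NLess (NConst 0) (NV ''best''))
         (Seq (shift add sub)
         (Seq (NAssign ''way'' (NV ''best'') (NV ''from''))
         (Seq (NAssign ''cur'' (NConst 0) (NV ''best''))
              (NAssign ''used'' (NV ''best'') (NConst 1)))))
         (NAssign ''i'' (NConst 0) (NPlus (NV ''n'') (NConst 1)))"
  let ?Q = "\<lambda>t s'. t \<le> 200 * (m + 2)\<^sup>2 \<and>
        (failed s' \<or> (\<exists>R' r' U' V'. searching s' k R' r' U' V' \<and> card R < card R'))"
  \<comment> \<open>These absorb the linear cost of the shift and the constant cost of the
    assignments into the quadratic cost of the scan.\<close>
  have H: "m + 2 \<le> (m + 2)\<^sup>2" "4 \<le> (m + 2)\<^sup>2"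
    using power_mono[of 2 "m + 2" 2] by (auto simp: power2_eq_square)
  have "wp p n m v ?grow (\<lambda>t'. ?Q (t + t')) s1"
    if t: "t \<le> 120 * (m + 2)\<^sup>2" and y: "\<forall>j. nmem s1 ''y'' j = 0"
      and best: "best_in s1 (slack own U V) (leaving own R)"
      and ag: "agree_off {''a'', ''b'', ''y'', ''best'', ''from''} {''w'', ''d'', ''delta''} s s1"
    for t s1
  proof (cases "nmem s1 ''best'' 0 = 0")
    case True
    then have none: "leaving own R = {}" using best by (simp add: best_in_def)
    have "\<not> saturating \<sigma>" for \<sigma>
    proof
      assume \<sigma>: "saturating \<sigma>"
      show False
      proof (rule search_state_stuck[OF st _ k(2)])
        show "own (nmem s ''cur'' 0) \<noteq> 0" using cur by (simp add: own_def)
        show "inj_on \<sigma> {1..n}" using \<sigma> by (simp add: saturating_def)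
      next
        fix a b assume "a \<in> R" "b \<notin> R" "b \<le> m"
        moreover have "0 \<in> R" using st by (simp add: search_state_def alternating_tree_def)
        ultimately have "b \<in> {1..m}" by (cases b) auto
        then show "\<not> accepts (own a) b"
          using none \<open>a \<in> R\<close> \<open>b \<notin> R\<close> by (auto simp: leaving_def)
      qed (use \<sigma> in \<open>auto simp: saturating_def\<close>)
    qed
    moreover have "own j \<le> n" if "j \<in> {1..m}" for j
      using tight_matching_owner_le[of k "Suc m" own U V j] st that k by (auto simp: search_state_def)
    moreover have "nmem s1 ''owner'' = own" "sizes s1"
      using agree_offD[OF ag] rd by (auto simp: own_def ready_def sizes_def)
    ultimately have "failed (nupd ''i'' 0 (Suc n) s1)"
      using y by (auto simp: failed_def ready_def sizes_def)
    moreover have "nmem s1 ''n'' 0 = n" using \<open>sizes s1\<close> by (simp add: sizes_def)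
    ultimately show ?thesis using True t H(2) by simp
  next
    case False
    define a b where "a = nmem s1 ''from'' 0" and "b = nmem s1 ''best'' 0"
    define d where "d = slack own U V (a, b)"
    define U' where "U' = (\<lambda>i. if i \<in> own ` R then U i + d else U i)"
    define V' where "V' = (\<lambda>j. if j \<in> R then V j - d else V j)"
    have ab: "(a, b) \<in> leaving own R" "rmem s1 ''delta'' 0 = E d"
      "\<And>x. x \<in> leaving own R \<Longrightarrow> d \<le> slack own U V x"
      using best False by (auto simp: best_in_def Let_def a_def b_def d_def)
    have "0 \<in> R" using st by (simp add: search_state_def alternating_tree_def)
    have step: "search_state k (insert b R) b own (way(b := a)) (r(b := card R)) U' V'"
      unfolding U'_def V'_def
    proof (rule search_state_step[OF st])
      show "own (nmem s ''cur'' 0) \<noteq> 0" using cur by (simp add: own_def)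
      show "a \<in> R" "b \<notin> R" "b \<le> m" "accepts (own a) b" using ab by (auto simp: leaving_def)
      show "d = \<kappa> (v (own a) {b}) - U (own a) - V b" by (simp add: d_def slack_def)
      fix a' b' assume "a' \<in> R" "b' \<notin> R" "b' \<le> m" "accepts (own a') b'"
      moreover from this have "b' \<noteq> 0" using \<open>0 \<in> R\<close> by metis
      ultimately show "d \<le> \<kappa> (v (own a') {b'}) - U (own a') - V b'"
        using ab(3)[of "(a', b')"] by (simp add: leaving_def slack_def)
    qed
    have ctx1: "search_context s1 k own R U V" by (rule search_context_agree[OF ctx ag])
    have sh: "wp p n m v (shift add sub)
       (\<lambda>t s'. t \<le> 50 * (m + 2) \<and> encodes s' k U' V' \<and> agree_off {''a''} {''u'', ''v''} s1 s') s1"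
      unfolding U'_def V'_def by (rule wp_shift[OF ctx1 R(3) ab(2)])
    have bv: "bval p s1 (NLess (NConst 0) (NV ''best'')) = True" using False by simp
    show ?thesis
      unfolding wp_loop_free(5,6) bv if_True
    proof (rule wp_mono[OF sh], goal_cases)
      case (1 t2 s2)
      note ag2 = agree_offD[OF conjunct2[OF conjunct2[OF 1]]]
      note ag1 = agree_offD[OF ag]
      let ?s = "nupd ''used'' b (Suc 0) (nupd ''cur'' 0 b (nupd ''way'' b a s2))"
      have m: "nmem s2 ''best'' 0 = b" "nmem s2 ''from'' 0 = a" by (simp_all add: ag2 a_def b_def)
      have "used_set ?s = insert b R"
        using ctx ab(1) by (auto simp: used_set_def search_context_def leaving_def ag1 ag2)
      moreover have "ready ?s"
        using rd y by (simp add: ready_def sizes_def ag1 ag2)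
      moreover have "encodes ?s k U' V'" using 1 by (simp add: encodes_def)
      ultimately have "searching ?s k (insert b R) (r(b := card R)) U' V'"
        using k step by (simp add: searching_def ag1 ag2 own_def way_def)
      moreover have "card R < card (insert b R)"
        using R(1) ab(1) by (simp add: leaving_def)
      ultimately show ?case using 1 t H by (auto simp: m)
    qed
  qed
  moreover have "wp p n m v (search sub price)
     (\<lambda>t s'. t \<le> 120 * (m + 2)\<^sup>2 \<and> (\<forall>j. nmem s' ''y'' j = 0) \<and>
        best_in s' (slack own U V) (leaving own R) \<and>
        agree_off {''a'', ''b'', ''y'', ''best'', ''from''} {''w'', ''d'', ''delta''} s s') s"
    using wp_search[OF ctx] rd by (simp add: ready_def)
  ultimately show ?thesis
    unfolding grow_def wp_loop_free(5) by (elim wp_mono) blast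
qed

lemma wp_search_loop:
  assumes "searching s k R r U V"
  shows "wp p n m v (While (BAnd (NLess (NConst 0) (NGet ''owner'' (NV ''cur''))) alive) (grow add sub price))
     (\<lambda>t s'. t \<le> 300 * (m + 2) ^ 3 \<and>
        (failed s' \<or> (\<exists>R r U V. searching s' k R r U V \<and> nmem s' ''owner'' (nmem s' ''cur'' 0) = 0))) s"
proof -
  let ?b = "BAnd (NLess (NConst 0) (NGet ''owner'' (NV ''cur''))) alive"
  \<comment> \<open>The variant counts the columns still outside the tree. The additional
    \<open>Suc\<close> leaves 0 free for the failed state, so that failing decreases the variant
    too.\<close>
  let ?I = "\<lambda>z s'. failed s' \<and> z = 0 \<or>
              (\<exists>R r U V. searching s' k R r U V \<and> z = Suc (Suc m - card R))"
  have le: "card R \<le> Suc m" "1 \<le> card R" if "searching s' k R r U V" for s' R r U V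
  proof -
    have "R \<subseteq> {..m}" "0 \<in> R"
      using that by (auto simp: searching_def search_state_def alternating_tree_def)
    then show "card R \<le> Suc m" "1 \<le> card R"
      using card_mono[of "{..m}" R] finite_subset[of R "{..m}"] by (auto simp: card_gt_0_iff Suc_le_eq)
  qed
  have "wp p n m v (While ?b (grow add sub price))
     (\<lambda>t s'. t \<le> (Suc (Suc m - card R) + 1) * (1 + bcost ?b + 200 * (m + 2)\<^sup>2) \<and>
        (\<exists>z. ?I z s') \<and> \<not> bval p s' ?b) s"
  proof (rule wp_While[where I = ?I])
    show "?I (Suc (Suc m - card R)) s" using assms by blast
  next
    fix z s'
    assume I: "?I z s'" and b: "bval p s' ?b"
    then have "\<not> failed s'" by (auto simp: alive_def failed_def ready_def sizes_def)
    then obtain R r U V where S: "searching s' k R r U V" "z = Suc (Suc m - card R)"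
      using I by blast
    have "nmem s' ''owner'' (nmem s' ''cur'' 0) \<noteq> 0" using b by simp
    note step = wp_grow[OF S(1) this]
    show "wp p n m v (grow add sub price)
            (\<lambda>t s''. t \<le> 200 * (m + 2)\<^sup>2 \<and> (\<exists>z'<z. ?I z' s'')) s'"
    proof (rule wp_mono[OF step], elim conjE disjE exE, goal_cases)
      case (1 t s'')
      then show ?case using S(2) by (intro conjI exI[of _ 0]) auto
    next
      case (2 t s'' R' r' U' V')
      have "Suc (Suc m - card R') < z" using S(2) le[OF 2(2)] 2(3) by simp
      then show ?case using 2 by blast
    qed
  qed
  then show ?thesis
  proof (rule wp_mono, goal_cases)
    case (1 t s')
    have "t \<le> (Suc (Suc m - card R) + 1) * (1 + bcost ?b + 200 * (m + 2)\<^sup>2)" using 1 by blast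
    also have "\<dots> \<le> (m + 2) * (300 * (m + 2)\<^sup>2)"
    proof (rule mult_mono)
      have "2\<^sup>2 \<le> (m + 2)\<^sup>2" by (rule power_mono) auto
      then show "1 + bcost ?b + 200 * (m + 2)\<^sup>2 \<le> 300 * (m + 2)\<^sup>2" by (simp add: alive_def)
    qed (use le(2)[OF assms] in auto)
    also have "\<dots> = 300 * (m + 2) ^ 3" by (simp only: power2_eq_square power3_eq_cube mult_ac)
    finally have "t \<le> 300 * (m + 2) ^ 3" .
    moreover have "nmem s' ''owner'' (nmem s' ''cur'' 0) = 0" if "searching s' k R r U V" for R r U V
      using 1 that by (auto simp: alive_def searching_def ready_def sizes_def)
    ultimately show ?case using 1 by blast
  qed
qed

lemma wp_augment:
  assumes "failed s \<or> (\<exists>R r U V. searching s k R r U V \<and> nmem s ''owner'' (nmem s ''cur'' 0) = 0)"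
  shows "wp p n m v augment
     (\<lambda>t s'. t \<le> 30 * (m + 2) \<and> (failed s' \<or> matched_up_to s' k)) s"
proof -
  let ?b = "BAnd (NLess (NConst 0) (NV ''cur'')) alive"
  let ?c = "Seq (NAssign ''owner'' (NV ''cur'') (NGet ''owner'' (NGet ''way'' (NV ''cur''))))
            (NAssign ''cur'' (NConst 0) (NGet ''way'' (NV ''cur'')))"
  let ?I = "\<lambda>z s'. failed s' \<or>
     (ready s' \<and> nmem s' ''i'' 0 = k \<and> k \<le> n \<and> (\<exists>R r U V. encodes s' k U V \<and>
        augment_state k R (nmem s' ''cur'' 0) (nmem s' ''owner'') (nmem s' ''way'') r U V \<and>
        r (nmem s' ''cur'' 0) = z))"
  \<comment> \<open>The variant is the rank of the hole, which drops with every move to a parent. It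
    starts below \<open>card R\<close>, and the tree has at most \<open>m + 1\<close>
    columns.\<close>
  obtain z where z: "z \<le> m" "?I z s"
  proof (cases "failed s")
    case False
    then obtain R r U V where S: "searching s k R r U V" "nmem s ''owner'' (nmem s ''cur'' 0) = 0"
      using assms by blast
    then have st: "search_state k R (nmem s ''cur'' 0) (nmem s ''owner'') (nmem s ''way'') r U V"
      by (simp add: searching_def)
    then have "R \<subseteq> {..m}" "r (nmem s ''cur'' 0) < card R"
      by (auto simp: search_state_def alternating_tree_def)
    then have "r (nmem s ''cur'' 0) \<le> m" using card_mono[of "{..m}" R] by auto
    then show thesis
      using S search_state_found[OF st S(2)] by (intro that[OF _ disjI2]) (auto simp: searching_def)
  qed (use that in auto)
  have "wp p n m v (While ?b ?c)
     (\<lambda>t s'. t \<le> (z + 1) * (1 + bcost ?b + 15) \<and> (\<exists>z. ?I z s') \<and> \<not> bval p s' ?b) s"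
  proof (rule wp_While[where I = ?I])
    show "?I z s" by (rule z(2))
  next
    fix z s'
    assume I: "?I z s'" and b: "bval p s' ?b"
    then have "\<not> failed s'" by (auto simp: alive_def failed_def ready_def sizes_def)
    then obtain R r U V where S: "ready s'" "nmem s' ''i'' 0 = k" "k \<le> n" "encodes s' k U V"
      "augment_state k R (nmem s' ''cur'' 0) (nmem s' ''owner'') (nmem s' ''way'') r U V"
      "r (nmem s' ''cur'' 0) = z" using I by blast
    have "nmem s' ''cur'' 0 \<noteq> 0" using b by simp
    note step = augment_state_step[OF S(5) this]
    let ?s = "nupd ''cur'' 0 (nmem s' ''way'' (nmem s' ''cur'' 0)) (nupd ''owner'' (nmem s' ''cur'' 0)
                (nmem s' ''owner'' (nmem s' ''way'' (nmem s' ''cur'' 0))) s')"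
    have "ready ?s" "encodes ?s k U V" using S by (auto simp: ready_def sizes_def encodes_def)
    then have I': "?I (r (nmem s' ''way'' (nmem s' ''cur'' 0))) ?s" using S step by auto
    have "wp p n m v ?c (\<lambda>t s''. t \<le> 15 \<and> s'' = ?s) s'" by simp
    then show "wp p n m v ?c (\<lambda>t s''. t \<le> 15 \<and> (\<exists>z'<z. ?I z' s'')) s'"
    proof (rule wp_mono)
      fix t s'' assume "t \<le> 15 \<and> s'' = ?s"
      moreover have "r (nmem s' ''way'' (nmem s' ''cur'' 0)) < z" using step(2) S(6) by simp
      ultimately show "t \<le> 15 \<and> (\<exists>z'<z. ?I z' s'')" using I' by blast
    qed
  qed
  then show ?thesis
    unfolding augment_def
  proof (rule wp_mono, goal_cases)
    case (1 t s')
    have "t \<le> (z + 1) * (1 + bcost ?b + 15)" using 1 by blast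
    also have "\<dots> \<le> (m + 2) * 30" by (rule mult_mono) (use z in \<open>auto simp: alive_def\<close>)
    finally have "t \<le> 30 * (m + 2)" by simp
    moreover have "matched_up_to s' k" if nf: "\<not> failed s'"
    proof -
      obtain R r U V where S: "ready s'" "nmem s' ''i'' 0 = k" "k \<le> n" "encodes s' k U V"
        "augment_state k R (nmem s' ''cur'' 0) (nmem s' ''owner'') (nmem s' ''way'') r U V"
        using 1 nf by blast
      then have "nmem s' ''cur'' 0 = 0" using 1 by (simp add: alive_def ready_def sizes_def)
      with S(5) have "base_state k (nmem s' ''owner'') U V" using augment_state_finish by metis
      then show ?thesis using S by (auto simp: matched_up_to_def)
    qed
    ultimately show ?case by blast
  qed
qed

lemma wp_start_phase:
  assumes S: "matched_up_to s k" and "k < n"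
  shows "wp p n m v (start_phase nought)
     (\<lambda>t s'. t \<le> 50 * (m + 2) \<and> (\<exists>U V. searching s' (Suc k) {0} (\<lambda>_. 0) U V)) s"
proof -
  obtain U V where rd: "ready s" "nmem s ''i'' 0 = k" and
    base: "base_state k (nmem s ''owner'') U V" "encodes s k U V"
    using S by (auto simp: matched_up_to_def)
  define U' where "U' = U(Suc k := 0)"
  define s1 where "s1 = nupd ''cur'' 0 0 (rupd ''u'' (Suc k) (E 0)
                         (nupd ''owner'' 0 (Suc k) (nupd ''i'' 0 (Suc k) s)))"
  let ?c = "NAssign ''used'' (NV ''a'') (NConst 0)"
  have "encodes s1 (Suc k) U' V" using base(2) by (auto simp: encodes_def s1_def U'_def le_Suc_eq)
  have "wp p n m v (For ''a'' 0 ''m'' ?c)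
     (\<lambda>t s'. t \<le> (m + 2) * (5 + 15) \<and> (\<forall>j<Suc m. nmem s' ''used'' j = 0) \<and>
        agree_off (insert ''a'' (nwrites ?c)) (rwrites ?c) s1 s') s1"
  proof (rule wp_For[where I = "\<lambda>a s'. \<forall>j<a. nmem s' ''used'' j = 0"])
    show "nmem s1 ''m'' 0 = m" using rd by (simp add: s1_def ready_def sizes_def)
  qed (auto simp: less_Suc_eq)
  then have "wp p n m v (For ''a'' 0 ''m'' ?c)
     (\<lambda>t s'. 22 + t \<le> 50 * (m + 2) \<and>
        searching (nupd ''used'' 0 (Suc 0) s') (Suc k) {0} (\<lambda>_. 0) U' V) s1"
  proof (rule wp_mono, goal_cases)
    case (1 t s2)
    let ?s = "nupd ''used'' 0 (Suc 0) s2"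
    have ag: "agree_off {''a'', ''used''} {} s1 s2"
      using 1 by simp
    note ag = agree_offD[OF ag]
    have "used_set ?s = {0}" using 1 by (auto simp: used_set_def)
    moreover have "ready ?s" using rd by (simp add: ready_def sizes_def ag s1_def)
    moreover have "encodes ?s (Suc k) U' V"
      using \<open>encodes s1 (Suc k) U' V\<close> by (simp add: encodes_def ag)
    moreover have "search_state (Suc k) {0} 0 ((nmem s ''owner'')(0 := Suc k)) (nmem s ''way'')
       (\<lambda>_. 0) U' V"
      unfolding U'_def by (rule search_state_start[OF base(1)])
    ultimately have "searching ?s (Suc k) {0} (\<lambda>_. 0) U' V"
      using \<open>k < n\<close> by (simp add: searching_def ag s1_def)
    then show ?case using 1 by simp
  qed
  then show ?thesis
    using rd by (simp add: start_phase_def s1_def rval_nought rcost_nought)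
      (erule wp_mono; simp; blast)
qed

lemma wp_phase:
  assumes S: "matched_up_to s k" and "k < n"
  shows "wp p n m v (phase nought add sub price)
     (\<lambda>t s'. t \<le> 400 * (m + 2) ^ 3 \<and> (failed s' \<or> matched_up_to s' (Suc k))) s"
  unfolding phase_def wp_loop_free(5)
proof (rule wp_mono[OF wp_start_phase[OF assms]], elim conjE exE, goal_cases)
  case (1 t1 s1 U V)
  show ?case
  proof (rule wp_mono[OF wp_search_loop[OF 1(2)]], goal_cases)
    case (1 t2 s2)
    note t2 = conjunct1[OF 1]
    show ?case
    proof (rule wp_mono[OF wp_augment[OF conjunct2[OF 1]]], goal_cases)
      case (1 t3 s3)
      have "m + 2 \<le> (m + 2) ^ 3" by (rule self_le_power) auto
      moreover have "a + (b + c) \<le> 400 * y"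
        if "x \<le> y" "a \<le> 50 * x" "b \<le> 300 * y" "c \<le> 30 * x" for a b c x y :: nat
        using that by linarith
      ultimately show ?case using 1 t2 \<open>t1 \<le> 50 * (m + 2)\<close> by blast
    qed
  qed
qed

text \<open>The optimality claim is conditional because a stuck phase leaves only legal owners and
  the absence of a saturating assignment. As n \<le> m, there are at most \<open>m\<close> phases of
  cubic cost, which gives a quartic bound in \<open>m\<close> alone.\<close>

lemma wp_matching_program:
  assumes init: "s = init_store n m" and "1 \<le> n"
  shows "wp p n m v (matching_program nought add sub price)
     (\<lambda>t s'. t \<le> 500 * (m + 2) ^ 4 \<and> (\<forall>j\<in>{1..m}. nmem s' ''owner'' j \<in> {1..n}) \<and>
        ((\<exists>\<sigma>. saturating \<sigma>) \<longrightarrow>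
         (\<exists>\<mu>. (\<forall>i\<in>{1..n}. \<mu> i \<in> {1..m} \<and> nmem s' ''owner'' (\<mu> i) = i \<and> accepts i (\<mu> i)) \<and>
           (\<forall>\<sigma>. saturating \<sigma> \<longrightarrow>
              (\<Sum>i\<in>{1..n}. \<kappa> (v i {\<mu> i})) \<le> (\<Sum>i\<in>{1..n}. \<kappa> (v i {\<sigma> i})))))) s"
proof -
  let ?c1 = "RAssign ''v'' (NV ''a'') nought"
  let ?c3 = "If (NLess (NConst 0) (NGet ''owner'' (NV ''b''))) Skip
              (NAssign ''owner'' (NV ''b'') (NConst 1))"
  let ?b = "NLess (NV ''i'') (NV ''n'')"
  let ?good = "\<lambda>s'. (\<exists>\<sigma>. saturating \<sigma>) \<longrightarrow>
         (\<exists>\<mu>. (\<forall>i\<in>{1..n}. \<mu> i \<in> {1..m} \<and> nmem s' ''owner'' (\<mu> i) = i \<and> accepts i (\<mu> i)) \<and>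
           (\<forall>\<sigma>. saturating \<sigma> \<longrightarrow>
              (\<Sum>i\<in>{1..n}. \<kappa> (v i {\<mu> i})) \<le> (\<Sum>i\<in>{1..n}. \<kappa> (v i {\<sigma> i}))))"
  have 1: "wp p n m v (For ''a'' 0 ''m'' ?c1)
     (\<lambda>t s'. t \<le> (m + 2) * (10 + 15) \<and> (\<forall>j<Suc m. rmem s' ''v'' j = E 0) \<and>
        agree_off (insert ''a'' (nwrites ?c1)) (rwrites ?c1) s s') s"
  proof (rule wp_For[where I = "\<lambda>a s'. \<forall>j<a. rmem s' ''v'' j = E 0"])
    show "nmem s ''m'' 0 = m" by (simp add: init init_store_def)
  qed (auto simp: less_Suc_eq rval_nought rcost_nought)
  have 2: "wp p n m v (While ?b (phase nought add sub price))
     (\<lambda>t s'. t \<le> 405 * (m + 2) ^ 4 \<and> sizes s' \<and> (\<forall>j\<in>{1..m}. nmem s' ''owner'' j \<le> n) \<and> ?good s') s1"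
    if "matched_up_to s1 0" for s1
  proof -
    let ?I = "\<lambda>z s'. failed s' \<or> (\<exists>k. matched_up_to s' k \<and> z = n - k)"
    have "wp p n m v (While ?b (phase nought add sub price))
     (\<lambda>t s'. t \<le> (n + 1) * (1 + bcost ?b + 400 * (m + 2) ^ 3) \<and> (\<exists>z. ?I z s') \<and> \<not> bval p s' ?b) s1"
    proof (rule wp_While[where I = ?I])
      show "?I n s1" using that by auto
    next
      fix z s'
      assume I: "?I z s'" and b: "bval p s' ?b"
      then have "\<not> failed s'" by (auto simp: failed_def ready_def sizes_def)
      then obtain k where S: "matched_up_to s' k" "z = n - k" using I by blast
      then have "k < n" using b by (simp add: matched_up_to_def ready_def sizes_def)
      show "wp p n m v (phase nought add sub price)
        (\<lambda>t s''. t \<le> 400 * (m + 2) ^ 3 \<and> (\<exists>z'<z. ?I z' s'')) s'"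
      proof (rule wp_mono[OF wp_phase[OF S(1) \<open>k < n\<close>]], goal_cases)
        case (1 t s'')
        have "n - Suc k < z" using S(2) \<open>k < n\<close> by simp
        then show ?case using 1 by blast
      qed
    qed
    then show ?thesis
    proof (rule wp_mono, goal_cases)
      case (1 t s')
      have "t \<le> (n + 1) * (1 + bcost ?b + 400 * (m + 2) ^ 3)" using 1 by blast
      also have "\<dots> \<le> (m + 2) * (405 * (m + 2) ^ 3)"
      proof (rule mult_mono)
        have "2 ^ 3 \<le> (m + 2) ^ 3" by (rule power_mono) auto
        then show "1 + bcost ?b + 400 * (m + 2) ^ 3 \<le> 405 * (m + 2) ^ 3" by simp
      qed (use n_le_m in auto)
      also have "\<dots> = 405 * (m + 2) ^ 4"
        by (simp only: mult.left_commute[of "m + 2"] power_Suc[symmetric]) simp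
      finally have t: "t \<le> 405 * (m + 2) ^ 4" .
      show ?case
      proof (cases "failed s'")
        case True
        then show ?thesis using t by (auto simp: failed_def ready_def)
      next
        case False
        then obtain k where k: "matched_up_to s' k" using 1 by blast
        then have "k = n" "sizes s'" using 1 by (auto simp: matched_up_to_def ready_def sizes_def)
        with k obtain U V where base: "base_state n (nmem s' ''owner'') U V"
          by (auto simp: matched_up_to_def)
        have "nmem s' ''owner'' j \<le> n" if "j \<in> {1..m}" for j
          using base that tight_matching_owner_le[of n 0 "nmem s' ''owner''" U V j]
          by (auto simp: base_state_def)
        moreover have "?good s'"
        proof (rule base_state_optimal[OF base], intro impI exI conjI)
          fix \<mu>
          assume \<mu>: "\<And>i. i \<in> {1..n} \<Longrightarrow> \<mu> i \<in> {1..m} \<and> nmem s' ''owner'' (\<mu> i) = i \<and> accepts i (\<mu> i)"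
            "\<And>\<sigma>. inj_on \<sigma> {1..n} \<Longrightarrow> (\<And>i. i \<in> {1..n} \<Longrightarrow> \<sigma> i \<in> {1..m} \<and> accepts i (\<sigma> i)) \<Longrightarrow>
               (\<Sum>i\<in>{1..n}. \<kappa> (v i {\<mu> i})) \<le> (\<Sum>i\<in>{1..n}. \<kappa> (v i {\<sigma> i}))"
          show "\<forall>i\<in>{1..n}. \<mu> i \<in> {1..m} \<and> nmem s' ''owner'' (\<mu> i) = i \<and> accepts i (\<mu> i)"
            using \<mu>(1) by blast
          show "\<forall>\<sigma>. saturating \<sigma> \<longrightarrow>
             (\<Sum>i\<in>{1..n}. \<kappa> (v i {\<mu> i})) \<le> (\<Sum>i\<in>{1..n}. \<kappa> (v i {\<sigma> i}))"
            unfolding saturating_def using \<mu>(2) by blast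
        qed
        ultimately show ?thesis using t \<open>sizes s'\<close> by blast
      qed
    qed
  qed
  have 3: "wp p n m v (For ''b'' 1 ''m'' ?c3)
     (\<lambda>t s'. t \<le> (m + 2) * (12 + 15) \<and>
        (\<forall>j. nmem s' ''owner'' j = (if j \<in> {1..<Suc m} \<and> nmem s2 ''owner'' j = 0 then 1 else nmem s2 ''owner'' j)) \<and>
        agree_off (insert ''b'' (nwrites ?c3)) (rwrites ?c3) s2 s') s2" if "sizes s2" for s2
  proof (rule wp_For[where I = "\<lambda>b s'. \<forall>j. nmem s' ''owner'' j =
      (if j \<in> {1..<b} \<and> nmem s2 ''owner'' j = 0 then 1 else nmem s2 ''owner'' j)"])
    show "nmem s2 ''m'' 0 = m" using that by (simp add: sizes_def)
  qed (auto simp: less_Suc_eq)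
  show ?thesis
    unfolding matching_program_def wp_loop_free(5)
  proof (rule wp_mono[OF 1], goal_cases)
    case (1 t1 s1)
    note t1 = conjunct1[OF 1]
    have ag: "agree_off {''a''} {''v''} s s1" using 1 by simp
    note ag = agree_offD[OF ag]
    have "base_state 0 (nmem s1 ''owner'') (\<lambda>_. 0) (\<lambda>_. 0)"
      by (simp add: ag init init_store_def base_state_def tight_matching_def matched_def dual_feasible_def bij_betw_def)
    moreover have "encodes s1 0 (\<lambda>_. 0) (\<lambda>_. 0)" using 1 by (simp add: encodes_def)
    ultimately have "matched_up_to s1 0"
      by (auto simp: matched_up_to_def ready_def sizes_def ag init init_store_def)
    show ?case
    proof (rule wp_mono[OF 2[OF \<open>matched_up_to s1 0\<close>]], goal_cases)
      case (1 t2 s2)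
      note s2 = 1
      then have "sizes s2" by blast
      show ?case
      proof (rule wp_mono[OF 3[OF \<open>sizes s2\<close>]], goal_cases)
        case (1 t3 s3)
        \<comment> \<open>Since \<open>m + 2\<close> is at least 2, eight times it is below its
          fourth power; this pays for the initial and the final loop.\<close>
        have "(m + 2) * 2 ^ 3 \<le> (m + 2) * (m + 2) ^ 3" by (intro mult_left_mono power_mono) auto
        then have "(m + 2) * 8 \<le> (m + 2) ^ 4" by (simp only: power_Suc[symmetric]) simp
        moreover have "a + (b + c) \<le> 500 * y"
          if "x * 8 \<le> y" "a \<le> x * 25" "b \<le> 405 * y" "c \<le> x * 27" for a b c x y :: nat
          using that by linarith
        moreover have "t1 \<le> (m + 2) * 25" "t3 \<le> (m + 2) * 27" using t1 1 by auto
        ultimately have "t1 + (t2 + t3) \<le> 500 * (m + 2) ^ 4" using s2 by blast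
        moreover have "nmem s3 ''owner'' j \<in> {1..n}" if "j \<in> {1..m}" for j
          using 1 s2 that \<open>1 \<le> n\<close> by (auto simp: Suc_le_eq)
        moreover have "?good s3"
        proof
          assume "\<exists>\<sigma>. saturating \<sigma>"
          then obtain \<mu> where \<mu>: "\<forall>i\<in>{1..n}. \<mu> i \<in> {1..m} \<and> nmem s2 ''owner'' (\<mu> i) = i \<and> accepts i (\<mu> i)"
            "\<forall>\<sigma>. saturating \<sigma> \<longrightarrow>
              (\<Sum>i\<in>{1..n}. \<kappa> (v i {\<mu> i})) \<le> (\<Sum>i\<in>{1..n}. \<kappa> (v i {\<sigma> i}))"
            using s2 by blast
          \<comment> \<open>The final loop overwrites only zero entries, and the owner
            \<open>i\<close> of \<open>\<mu> i\<close> is at least 1.\<close>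
          then have "nmem s3 ''owner'' (\<mu> i) = i" if "i \<in> {1..n}" for i
            using 1 that by simp
          then show "\<exists>\<mu>. (\<forall>i\<in>{1..n}. \<mu> i \<in> {1..m} \<and> nmem s3 ''owner'' (\<mu> i) = i \<and> accepts i (\<mu> i)) \<and>
           (\<forall>\<sigma>. saturating \<sigma> \<longrightarrow>
              (\<Sum>i\<in>{1..n}. \<kappa> (v i {\<mu> i})) \<le> (\<Sum>i\<in>{1..n}. \<kappa> (v i {\<sigma> i})))"
            using \<mu> by blast
        qed
        ultimately show ?case by blast
      qed
    qed
  qed
qed

end

section \<open>Approximation guarantee\<close>

text \<open>For \<open>p < 0\<close> the outer exponent \<open>1 / p\<close> reverses the order, so
  a large mean means a small power sum; the minus sign of the logarithm has the same effect for
  \<open>p = 0\<close>.\<close>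

definition welfare_cost :: "real \<Rightarrow> real \<Rightarrow> real" where
  "welfare_cost p w = (if p = 0 then - ln w else w powr p)"

text \<open>For \<open>p = 0\<close> the encoded price \<open>exp (- ln w)\<close> is just
  \<open>1 / w\<close>, and sums and differences of potentials turn into products and quotients, all
  within machine arithmetic. For \<open>p < 0\<close> the price is what \<open>RPower\<close>
  computes.\<close>

lemma encoded_prices_exist:
  "\<exists>E nought add sub price. encoded_prices p E (welfare_cost p) nought add sub price"
proof (cases "p = 0")
  case True
  have "encoded_prices p exp (welfare_cost p) (RConst 1) RTimes RDivide (\<lambda>e. RDivide (RConst 1) e)"
    by unfold_locales
      (auto simp: welfare_cost_def True exp_add exp_diff exp_minus inverse_eq_divide)
  then show ?thesis by blast
next
  case False
  have "encoded_prices p (\<lambda>x. x) (welfare_cost p) (RConst 0) RPlus RMinus RPower"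
    by unfold_locales (auto simp: welfare_cost_def False)
  then show ?thesis by blast
qed

lemma p_mean_nonneg:
  assumes "\<And>i. i \<in> {1..n} \<Longrightarrow> 0 \<le> v i (A i)"
  shows "0 \<le> p_mean p n v A"
  using assms by (auto simp: p_mean_def intro!: real_root_ge_zero prod_nonneg)

lemma p_mean_zero:
  assumes "i \<in> {1..n}" "v i (A i) = 0"
  shows "p_mean p n v A = 0"
proof -
  have "(\<Prod>i\<in>{1..n}. v i (A i)) = 0" using assms by (intro prod_zero) auto
  then show ?thesis using assms by (auto simp: p_mean_def)
qed

text \<open>Here \<open>x i\<close> is the value of the good assigned to agent \<open>i\<close> and
  \<open>y i\<close> that of the best good in \<open>A i\<close>. The mean is monotone and
  homogeneous: it is at most \<open>K\<close> times the mean of the \<open>y i\<close> for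
  \<open>A\<close>, the cost comparison passes from \<open>y\<close> to \<open>x\<close>, and the
  bundles \<open>P i\<close> are worth at least \<open>x i\<close>.\<close>

lemma p_mean_approx:
  assumes p: "p \<le> 0" and n: "1 \<le> n" and K: "0 < K"
    and P: "\<And>i. i \<in> {1..n} \<Longrightarrow> 0 < x i \<and> x i \<le> v i (P i)"
    and A: "\<And>i. i \<in> {1..n} \<Longrightarrow> 0 < v i (A i) \<and> v i (A i) \<le> K * y i"
    and cost: "(\<Sum>i\<in>{1..n}. welfare_cost p (x i)) \<le> (\<Sum>i\<in>{1..n}. welfare_cost p (y i))"
  shows "1 / K * p_mean p n v A \<le> p_mean p n v P"
proof -
  have y: "0 < y i" if "i \<in> {1..n}" for i
    using A[OF that] K by (metis order_less_le_trans zero_less_mult_pos)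
  show ?thesis
  proof (cases "p = 0")
    case True
    have "(\<Prod>i\<in>{1..n}. v i (A i)) \<le> (\<Prod>i\<in>{1..n}. K * y i)"
      using A by (intro prod_mono) (auto intro: less_imp_le)
    also have "\<dots> = K ^ n * (\<Prod>i\<in>{1..n}. y i)" by (simp add: prod.distrib)
    also have "(\<Prod>i\<in>{1..n}. y i) \<le> (\<Prod>i\<in>{1..n}. x i)"
    proof -
      have "(\<Sum>i\<in>{1..n}. ln (y i)) \<le> (\<Sum>i\<in>{1..n}. ln (x i))"
        using cost by (simp add: True welfare_cost_def sum_negf)
      moreover have "y i \<noteq> 0" "x i \<noteq> 0" if "i \<in> {1..n}" for i
        using y[OF that] P[OF that] by auto
      then have "ln (\<Prod>i\<in>{1..n}. y i) = (\<Sum>i\<in>{1..n}. ln (y i))"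
        "ln (\<Prod>i\<in>{1..n}. x i) = (\<Sum>i\<in>{1..n}. ln (x i))"
        by (blast intro: ln_prod)+
      moreover have "0 < (\<Prod>i\<in>{1..n}. y i)" "0 < (\<Prod>i\<in>{1..n}. x i)"
        using y P by (auto intro!: prod_pos)
      ultimately show ?thesis by (metis ln_le_cancel_iff)
    qed
    also have "(\<Prod>i\<in>{1..n}. x i) \<le> (\<Prod>i\<in>{1..n}. v i (P i))"
      using P by (intro prod_mono) (auto intro: less_imp_le)
    finally have "root n (\<Prod>i\<in>{1..n}. v i (A i)) \<le> root n (K ^ n * (\<Prod>i\<in>{1..n}. v i (P i)))"
      using K n by (intro real_root_le_mono) (auto simp: mult_left_mono)
    also have "\<dots> = K * root n (\<Prod>i\<in>{1..n}. v i (P i))"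
      using K n by (simp add: real_root_mult real_root_power_cancel)
    finally show ?thesis using K by (simp add: p_mean_def True field_simps)
  next
    case False
    then have "p < 0" using p by simp
    have xP: "0 < v i (P i)" if "i \<in> {1..n}" for i
      using P[OF that] by linarith
    let ?SA = "\<Sum>i\<in>{1..n}. v i (A i) powr p" and ?SP = "\<Sum>i\<in>{1..n}. v i (P i) powr p"
    have "?SP \<le> (\<Sum>i\<in>{1..n}. x i powr p)"
      using P \<open>p < 0\<close> by (intro sum_mono powr_mono2') auto
    also have "\<dots> \<le> (\<Sum>i\<in>{1..n}. y i powr p)"
      using cost by (simp add: welfare_cost_def False)
    also have "\<dots> \<le> (\<Sum>i\<in>{1..n}. (1 / K * v i (A i)) powr p)"
      using A \<open>p < 0\<close> K by (intro sum_mono powr_mono2') (auto simp: field_simps)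
    also have "\<dots> = (1 / K) powr p * ?SA"
      unfolding sum_distrib_left using A K by (intro sum.cong refl powr_mult)
    finally have le: "1 / real n * ?SP \<le> (1 / K) powr p * (1 / real n * ?SA)"
      using n by (simp add: field_simps)
    \<comment> \<open>The outer power has a negative exponent, and its antitonicity requires a
      positive smaller base.\<close>
    have pos: "0 < 1 / real n * ?SP"
      using xP n by (intro mult_pos_pos sum_pos) (auto simp: less_imp_neq[symmetric])
    \<comment> \<open>Homogeneity: the factor \<open>(1 / K) powr p\<close> leaves the outer power
      as \<open>1 / K\<close>.\<close>
    have "1 / K * (1 / real n * ?SA) powr (1 / p) = ((1 / K) powr p * (1 / real n * ?SA)) powr (1 / p)"
      using K \<open>p < 0\<close> by (subst powr_mult) (auto simp: powr_powr intro!: sum_nonneg)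
    also have "\<dots> \<le> (1 / real n * ?SP) powr (1 / p)"
      using le pos \<open>p < 0\<close> by (intro powr_mono2') (auto simp: divide_simps)
    finally have "1 / K * (1 / real n * ?SA) powr (1 / p) \<le> (1 / real n * ?SP) powr (1 / p)" .
    moreover have "\<not> (\<exists>i\<in>{1..n}. v i (P i) = 0)" "\<not> (\<exists>i\<in>{1..n}. v i (A i) = 0)"
      using xP A by (metis order_less_irrefl)+
    ultimately show ?thesis
      using False unfolding p_mean_def by simp
  qed
qed

section \<open>From bundles to single goods\<close>

lemma subadditive_sum:
  assumes "normalized_valuation u" "subadditive_valuation m u" "S \<subseteq> {1..m}"
  shows "u S \<le> (\<Sum>g\<in>S. u {g})"
proof -
  have "finite S" using assms(3) finite_subset by blast
  then show ?thesis
    using assms(3)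
  proof (induction S)
    case empty
    then show ?case using assms(1) by (simp add: normalized_valuation_def)
  next
    case (insert g S)
    have "u (insert g S) \<le> u {g} + u S"
      using assms(2) insert.prems unfolding subadditive_valuation_def
      by (metis insert_is_Un insert_subset empty_subsetI)
    then show ?case using insert by simp
  qed
qed

text \<open>The largest singleton value is at least the average over \<open>S\<close>, and the sum
  of the singleton values bounds \<open>u S\<close>.\<close>

lemma subadditive_best_good:
  assumes "normalized_valuation u" "subadditive_valuation m u" "S \<subseteq> {1..m}" "S \<noteq> {}"
  obtains g where "g \<in> S" "u S \<le> real (card S) * u {g}"
proof -
  have fin: "finite S" using assms(3) finite_subset by blast
  define M where "M = Max ((\<lambda>g. u {g}) ` S)"
  have "M \<in> (\<lambda>g. u {g}) ` S" unfolding M_def using fin assms(4) by (intro Max_in) auto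
  then obtain g where g: "g \<in> S" "M = u {g}" by auto
  have "u S \<le> (\<Sum>g\<in>S. u {g})" using assms(1-3) by (rule subadditive_sum)
  also have "\<dots> \<le> real (card S) * M"
    by (rule sum_bounded_above) (simp add: M_def fin)
  finally show ?thesis using that g by simp
qed

text \<open>The other \<open>n - 1\<close> bundles take at least one of the \<open>m\<close> goods
  each.\<close>

lemma allocation_card_le:
  assumes A: "A \<in> allocations n m" and "\<And>i. i \<in> {1..n} \<Longrightarrow> A i \<noteq> {}" and i: "i \<in> {1..n}"
  shows "card (A i) \<le> m - n + 1"
proof -
  have fin: "finite (A j)" if "j \<in> {1..n}" for j
    using A that finite_subset[of "A j" "{1..m}"] by (auto simp: allocations_def PiE_def Pi_def)
  have "card (\<Union>j\<in>{1..n}. A j) = (\<Sum>j\<in>{1..n}. card (A j))"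
    using A fin by (intro card_UN_disjoint) (auto simp: allocations_def disjoint_family_on_def)
  moreover have "(\<Union>j\<in>{1..n}. A j) = {1..m}" using A by (simp add: allocations_def)
  ultimately have "m = (\<Sum>j\<in>{1..n}. card (A j))" by simp
  also have "\<dots> = card (A i) + (\<Sum>j\<in>{1..n} - {i}. card (A j))"
    using i by (simp add: sum.remove)
  finally have "m = card (A i) + (\<Sum>j\<in>{1..n} - {i}. card (A j))" .
  moreover have "(\<Sum>j\<in>{1..n} - {i}. 1) \<le> (\<Sum>j\<in>{1..n} - {i}. card (A j))"
    using assms(2) fin by (intro sum_mono) (auto simp: Suc_le_eq card_gt_0_iff)
  ultimately have "card (A i) + (n - 1) \<le> m" using i by simp
  then show ?thesis using i by auto
qed

lemma finite_allocations: "finite (allocations n m)"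
proof (rule finite_subset)
  show "allocations n m \<subseteq> {1..n} \<rightarrow>\<^sub>E Pow {1..m}" by (auto simp: allocations_def)
qed (auto intro: finite_PiE)

lemma output_allocation_in_allocations:
  assumes "\<forall>j\<in>{1..m}. nmem s ''owner'' j \<in> {1..n}"
  shows "output_allocation n m s \<in> allocations n m"
  using assms by (auto simp: allocations_def output_allocation_def disjoint_family_on_def)

theorem theorem11:
  fixes p :: real
  assumes "p \<le> 0"
  shows "\<exists>(c :: com) (q :: nat poly). \<forall>(n :: nat) (m :: nat) (v :: nat \<Rightarrow> nat set \<Rightarrow> real).
    1 \<le> n \<and> n \<le> m \<and>
    (\<forall>i\<in>{1..n}. nonneg_valuation m (v i) \<and> normalized_valuation (v i) \<and>
       monotone_valuation m (v i) \<and> subadditive_valuation m (v i)) \<longrightarrow>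
    (\<exists>t s. exec p n m v c (init_store n m) t s \<and>
       t \<le> poly q (n + m + valuation_bits n m v) \<and>
       output_allocation n m s \<in> allocations n m \<and>
       p_mean p n v (output_allocation n m s) \<ge>
         1 / (real m - real n + 1) * Max (p_mean p n v ` allocations n m))"
proof -
  obtain E nought add sub price where enc: "encoded_prices p E (welfare_cost p) nought add sub price"
    using encoded_prices_exist by blast
  let ?c = "matching_program nought add sub price"
  \<comment> \<open>The step bound \<open>500 * (m + 2) ^ 4\<close> of the program, read as a
    polynomial; it is monotone, so it may be evaluated at an argument larger than
    \<open>m\<close>.\<close>
  let ?q = "[:500:] * [:2, 1:] ^ 4 :: nat poly"
  show ?thesis
  proof (intro exI[of _ ?c] exI[of _ ?q] allI impI, elim conjE)
    fix n m :: nat and v :: "nat \<Rightarrow> nat set \<Rightarrow> real"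
    assume n: "1 \<le> n" "n \<le> m"
      and val: "\<forall>i\<in>{1..n}. nonneg_valuation m (v i) \<and> normalized_valuation (v i) \<and>
       monotone_valuation m (v i) \<and> subadditive_valuation m (v i)"
    interpret encoded_prices p E "welfare_cost p" nought add sub price by (rule enc)
    interpret matching_run p E "welfare_cost p" nought add sub price n m v
      by unfold_locales (rule n(2))
    obtain t s where run: "exec p n m v ?c (init_store n m) t s" "t \<le> 500 * (m + 2) ^ 4"
      and owner: "\<forall>j\<in>{1..m}. nmem s ''owner'' j \<in> {1..n}"
      and opt: "(\<exists>\<sigma>. saturating \<sigma>) \<Longrightarrow>
         \<exists>\<mu>. (\<forall>i\<in>{1..n}. \<mu> i \<in> {1..m} \<and> nmem s ''owner'' (\<mu> i) = i \<and> 0 < v i {\<mu> i}) \<and>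
           (\<forall>\<sigma>. saturating \<sigma> \<longrightarrow>
              (\<Sum>i\<in>{1..n}. welfare_cost p (v i {\<mu> i})) \<le> (\<Sum>i\<in>{1..n}. welfare_cost p (v i {\<sigma> i})))"
      using wp_matching_program[OF refl n(1)] unfolding wp_def by blast
    define P where "P = output_allocation n m s"
    have P: "P \<in> allocations n m"
      unfolding P_def using owner by (rule output_allocation_in_allocations)
    have sub_m: "A i \<subseteq> {1..m}" if "A \<in> allocations n m" "i \<in> {1..n}" for A i
      using that by (auto simp: allocations_def)
    have nonneg: "0 \<le> v i S" if "i \<in> {1..n}" "S \<subseteq> {1..m}" for i S
      using val that by (auto simp: nonneg_valuation_def)
    have approx: "1 / (real m - real n + 1) * p_mean p n v A \<le> p_mean p n v P"
      if A: "A \<in> allocations n m" for A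
    \<comment> \<open>A worthless bundle makes the mean of \<open>A\<close> zero, so nonnegativity
      of the output suffices. A stuck search is compatible with this case only.\<close>
    proof (cases "\<exists>i\<in>{1..n}. v i (A i) = 0")
      case True
      then have "p_mean p n v A = 0" using p_mean_zero by blast
      moreover have "0 \<le> p_mean p n v P"
        using nonneg sub_m[OF P] by (intro p_mean_nonneg) blast
      ultimately show ?thesis by simp
    next
      case False
      have pos: "0 < v i (A i)" if "i \<in> {1..n}" for i
        using False nonneg[OF that sub_m[OF A that]] that by force
      have ne: "A i \<noteq> {}" if "i \<in> {1..n}" for i
        using pos[OF that] val that by (auto simp: normalized_valuation_def)
      have "\<exists>g\<in>A i. v i (A i) \<le> real (card (A i)) * v i {g}" if "i \<in> {1..n}" for i
        using subadditive_best_good[of "v i" m "A i"] val that sub_m[OF A that] ne by metis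
      then obtain \<sigma> where \<sigma>: "\<And>i. i \<in> {1..n} \<Longrightarrow> \<sigma> i \<in> A i"
        "\<And>i. i \<in> {1..n} \<Longrightarrow> v i (A i) \<le> real (card (A i)) * v i {\<sigma> i}" by metis
      have A_le: "v i (A i) \<le> (real m - real n + 1) * v i {\<sigma> i}" if "i \<in> {1..n}" for i
      proof -
        have "real (card (A i)) \<le> real m - real n + 1"
          using allocation_card_le[OF A ne that] n by linarith
        moreover have "0 \<le> v i {\<sigma> i}"
          using nonneg[OF that] sub_m[OF A that] \<sigma>(1)[OF that] by blast
        ultimately show ?thesis using \<sigma>(2)[OF that] by (meson mult_right_mono order_trans)
      qed
      \<comment> \<open>Disjoint bundles make the chosen goods distinct, and positive bundles make
        them acceptable. Hence the program has found an optimal assignment, and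
        \<open>\<sigma>\<close> is a competitor for it.\<close>
      have "saturating \<sigma>"
        unfolding saturating_def
      proof (intro conjI ballI)
        show "inj_on \<sigma> {1..n}"
        proof (rule inj_onI, rule ccontr)
          fix i j assume "i \<in> {1..n}" "j \<in> {1..n}" "\<sigma> i = \<sigma> j" "i \<noteq> j"
          moreover have "disjoint_family_on A {1..n}" using A by (simp add: allocations_def)
          ultimately show False
            using \<sigma>(1)[of i] \<sigma>(1)[of j] disjoint_family_onD[of A "{1..n}" i j] by auto
        qed
        fix i assume i: "i \<in> {1..n}"
        then show "\<sigma> i \<in> {1..m}" using \<sigma>(1) sub_m[OF A] by blast
        have "0 < (real m - real n + 1) * v i {\<sigma> i}" using pos[OF i] A_le[OF i] by linarith
        then show "0 < v i {\<sigma> i}" by (rule zero_less_mult_pos) (use n in linarith)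
      qed
      then obtain \<mu> where \<mu>: "\<forall>i\<in>{1..n}. \<mu> i \<in> {1..m} \<and> nmem s ''owner'' (\<mu> i) = i \<and> 0 < v i {\<mu> i}"
        "(\<Sum>i\<in>{1..n}. welfare_cost p (v i {\<mu> i})) \<le> (\<Sum>i\<in>{1..n}. welfare_cost p (v i {\<sigma> i}))"
        using opt by blast
      show ?thesis
      proof (rule p_mean_approx[OF assms n(1), where x = "\<lambda>i. v i {\<mu> i}" and y = "\<lambda>i. v i {\<sigma> i}"])
        show "0 < real m - real n + 1" using n by linarith
      next
        fix i assume i: "i \<in> {1..n}"
        have "{\<mu> i} \<subseteq> P i" using \<mu>(1) i by (simp add: P_def output_allocation_def)
        then have "v i {\<mu> i} \<le> v i (P i)"
          using val i sub_m[OF P i] unfolding monotone_valuation_def by blast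
        then show "0 < v i {\<mu> i} \<and> v i {\<mu> i} \<le> v i (P i)" using \<mu>(1) i by blast
        show "0 < v i (A i) \<and> v i (A i) \<le> (real m - real n + 1) * v i {\<sigma> i}"
          using pos A_le i by blast
      qed (rule \<mu>(2))
    qed
    have "Max (p_mean p n v ` allocations n m) \<in> p_mean p n v ` allocations n m"
      using P finite_allocations by (intro Max_in) auto
    then have "1 / (real m - real n + 1) * Max (p_mean p n v ` allocations n m) \<le> p_mean p n v P"
      using approx by auto
    moreover have "t \<le> poly ?q (n + m + valuation_bits n m v)"
    proof -
      have "poly ?q N = 500 * (2 + N) ^ 4" for N by simp
      moreover have "500 * (m + 2) ^ 4 \<le> 500 * (2 + (n + m + valuation_bits n m v)) ^ 4"
        by (intro mult_left_mono power_mono) auto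
      ultimately show ?thesis using run(2) by (metis order_trans)
    qed
    ultimately show "\<exists>t s. exec p n m v ?c (init_store n m) t s \<and>
       t \<le> poly ?q (n + m + valuation_bits n m v) \<and>
       output_allocation n m s \<in> allocations n m \<and>
       p_mean p n v (output_allocation n m s) \<ge>
         1 / (real m - real n + 1) * Max (p_mean p n v ` allocations n m)"
      using run(1) P unfolding P_def by blast
  qed
qed

end
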